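(* Let $\rho$ be the autocovariance function of the weakly stationary solution $X$ of the ARCH($\infty$) equations with data $a$, $b$, $\xi$. Suppose that $\lambda_1B<1$ and $\Omega<1$, and that $\gamma\in\mathcal{W}^{\downarrow}(r)$ for some $r\in(0,1]$. Then the following are equivalent: (a) $\lambda_1\sum_{j=1}^\infty b(j)r^{-j}<1$ and there exists $C_0^\ast\in(0,\infty)$ such that $\limsup_{n\to\infty}\frac{b(n)}{\gamma(n)}=C_0^\ast$; (b) there exists $C_2^\ast\in(0,\infty)$ such that $\limsup_{n\to\infty}\frac{\rho(n)}{\gamma(n)}=C_2^\ast$.
   Context: ARCH($\infty$) setting. Let $\xi=\{\xi(k)\}_{k\in\mathbb{Z}}$ be i.i.d. non-negative random variables, $a\ge 0$ a constant, and $b=\{b(j)\}_{j\ge1}$ a real sequence with $b(j)\ge 0$. A random sequence $X=\{X(k)\}_{k\in\mathbb{Z}}$ satisfies the ARCH($\infty$) equations if $X(k)=\varsigma(k)\xi(k)$, $\varsigma(k)=a+\sum_{j=1}^\infty b(j)X(k-j)$ for all $k\in\mathbb{Z}$. Put $\lambda_1=\mathbb{E}[\xi(0)]$, $\lambda_2=\mathbb{E}[\xi(0)^2]$, $\sigma^2=\mathrm{Var}[\xi(0)]=\lambda_2-\lambda_1^2$, $B=\sum_{j=1}^\infty b(j)$, $\nu(k)=X(k)-\lambda_1\varsigma(k)$. Standing assumptions: $\lambda_1\in(0,\infty)$, $a>0$, $\sigma\in(0,\infty)$, and $b$ is not identically zero. The sequence $z$ is defined by $z(0)=1$, $z(n)=\lambda_1\sum_{j=0}^{n-1}b(n-j)z(j)$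 for $n\ge 1$ (when $\lambda_1B<1$, these are the power series coefficients of $1/(1-\lambda_1\sum_{j\ge1}b(j)\lambda^j)$ on $|\lambda|\le 1$), and $\Omega=\frac{\sigma}{\lambda_1}\big(\sum_{j=1}^\infty z(j)^2\big)^{1/2}$. A process is (weakly) stationary if it has constant finite mean and $\mathrm{Cov}[X(n),X(n+k)]$ depends only on $k$; $\rho(k)=\mathrm{Cov}[X(n),X(n+k)]$, $k\in\mathbb{Z}$, is its autocovariance function. Known fact (recalled by the paper): if $\lambda_1B<1$ and $\Omega<1$, there is a unique weakly stationary solution $X$ of the ARCH($\infty$) equations; it satisfies $\rho(k)=\mathbb{E}[\nu(0)^2]\sum_{j=0}^\infty z(j)z(j+|k|)$ for $k\in\mathbb{Z}$, with $\mathbb{E}[\nu(0)^2]=\big(\frac{a\sigma}{1-\lambda_1B}\big)^2\frac{1}{1-\Omega^2}$. Weight classes. For finite $r>0$, a real sequence $\gamma=\{\gamma(n)\}_{n\ge0}$ is in $\mathcal{W}(r)$ if $\gamma(n)>0$ for all $n\ge 0$, $\lim_{n\to\infty}\gamma(n-1)/\gamma(n)=1/r$, $\sum_{i=0}^\infty\gamma(i)r^{-i}<\infty$, and $\lim_{m\to\infty}\big(\limsup_{n\to\infty}\frac1{\gamma(n)}\sum_{i=m}^{n-m}\gamma(n-i)\gamma(i)\big)=0$. For $r\in(0,1]$, $\mathcal{W}^{\downarrow}(r)$ is the set of $g\in\mathcal{W}(r)$ for which there is a non-increasing positive sequence $\delta=\{\delta(n)\}_{n\ge0}$ with $g(n)/\delta(n)\to1$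 as $n\to\infty$. *)

theory Defs
  imports "HOL-Probability.Probability"
begin

text \<open>
  The kernel \<open>b :: nat \<Rightarrow> real\<close> is used at indices \<open>j \<ge> 1\<close> only; \<open>b 0\<close> is a dummy value. Sums over
  \<open>j \<ge> 1\<close> are written as sums of \<open>b (Suc j)\<close> over \<open>j :: nat\<close>. Since \<open>suminf\<close> and the Bochner
  integral are total, convergence and integrability are always required separately.
\<close>

definition cov :: "'a measure \<Rightarrow> ('a \<Rightarrow> real) \<Rightarrow> ('a \<Rightarrow> real) \<Rightarrow> real" where
  "cov M Y Z = (\<integral>\<omega>. (Y \<omega> - integral\<^sup>L M Y) * (Z \<omega> - integral\<^sup>L M Z) \<partial>M)"

definition weakly_stationary :: "'a measure \<Rightarrow> (int \<Rightarrow> 'a \<Rightarrow> real) \<Rightarrow> bool" where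
  "weakly_stationary M X \<longleftrightarrow>
     (\<forall>k. X k \<in> borel_measurable M \<and> integrable M (\<lambda>\<omega>. (X k \<omega>)\<^sup>2)) \<and>
     (\<forall>k l. integral\<^sup>L M (X k) = integral\<^sup>L M (X l)) \<and>
     (\<forall>n m k. cov M (X n) (X (n + k)) = cov M (X m) (X (m + k)))"

definition autocovariance_function :: "'a measure \<Rightarrow> (int \<Rightarrow> 'a \<Rightarrow> real) \<Rightarrow> (int \<Rightarrow> real) \<Rightarrow> bool" where
  "autocovariance_function M X \<rho> \<longleftrightarrow> (\<forall>n k. \<rho> k = cov M (X n) (X (n + k)))"

definition iid :: "'a measure \<Rightarrow> (int \<Rightarrow> 'a \<Rightarrow> real) \<Rightarrow> bool" where
  "iid M \<xi> \<longleftrightarrow> prob_space.indep_vars M (\<lambda>_. borel) \<xi> UNIV \<and>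
     (\<forall>k. distr M borel (\<xi> k) = distr M borel (\<xi> 0))"

definition volatility :: "real \<Rightarrow> (nat \<Rightarrow> real) \<Rightarrow> (int \<Rightarrow> 'a \<Rightarrow> real) \<Rightarrow> int \<Rightarrow> 'a \<Rightarrow> real" where
  "volatility a b X k \<omega> = a + (\<Sum>j. b (Suc j) * X (k - int (Suc j)) \<omega>)"

text \<open>As usual for random sequences, the equations are required to hold almost surely.\<close>

definition arch_solution ::
  "'a measure \<Rightarrow> real \<Rightarrow> (nat \<Rightarrow> real) \<Rightarrow> (int \<Rightarrow> 'a \<Rightarrow> real) \<Rightarrow> (int \<Rightarrow> 'a \<Rightarrow> real) \<Rightarrow> bool" where
  "arch_solution M a b \<xi> X \<longleftrightarrow>
     (\<forall>k. X k \<in> borel_measurable M) \<and>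
     (AE \<omega> in M. \<forall>k. summable (\<lambda>j. b (Suc j) * X (k - int (Suc j)) \<omega>) \<and>
                      X k \<omega> = volatility a b X k \<omega> * \<xi> k \<omega>)"

text \<open>The definite description ``the weakly stationary solution'': \<open>X\<close> is a weakly stationary
  solution, and any other one agrees with it almost surely.\<close>

definition the_stationary_solution ::
  "'a measure \<Rightarrow> real \<Rightarrow> (nat \<Rightarrow> real) \<Rightarrow> (int \<Rightarrow> 'a \<Rightarrow> real) \<Rightarrow> (int \<Rightarrow> 'a \<Rightarrow> real) \<Rightarrow> bool" where
  "the_stationary_solution M a b \<xi> X \<longleftrightarrow>
     weakly_stationary M X \<and> arch_solution M a b \<xi> X \<and>
     (\<forall>Y. weakly_stationary M Y \<and> arch_solution M a b \<xi> Y \<longrightarrow>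
            (AE \<omega> in M. \<forall>k. Y k \<omega> = X k \<omega>))"

definition arch_lambda1 :: "'a measure \<Rightarrow> (int \<Rightarrow> 'a \<Rightarrow> real) \<Rightarrow> real" where
  "arch_lambda1 M \<xi> = integral\<^sup>L M (\<xi> 0)"

definition arch_sigma :: "'a measure \<Rightarrow> (int \<Rightarrow> 'a \<Rightarrow> real) \<Rightarrow> real" where
  "arch_sigma M \<xi> = sqrt (prob_space.variance M (\<xi> 0))"

definition arch_B :: "(nat \<Rightarrow> real) \<Rightarrow> real" where
  "arch_B b = (\<Sum>j. b (Suc j))"

fun arch_z :: "real \<Rightarrow> (nat \<Rightarrow> real) \<Rightarrow> nat \<Rightarrow> real" where
  "arch_z l b 0 = 1"
| "arch_z l b (Suc n) = l * (\<Sum>j<Suc n. b (Suc n - j) * arch_z l b j)"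

definition arch_Omega :: "'a measure \<Rightarrow> (nat \<Rightarrow> real) \<Rightarrow> (int \<Rightarrow> 'a \<Rightarrow> real) \<Rightarrow> real" where
  "arch_Omega M b \<xi> = arch_sigma M \<xi> / arch_lambda1 M \<xi> *
     sqrt (\<Sum>j. (arch_z (arch_lambda1 M \<xi>) b (Suc j))\<^sup>2)"

definition weight_class :: "real \<Rightarrow> (nat \<Rightarrow> real) set" where
  "weight_class r = {\<gamma>.
     (\<forall>n. \<gamma> n > 0) \<and>
     (\<lambda>n. \<gamma> n / \<gamma> (Suc n)) \<longlonglongrightarrow> 1 / r \<and>
     summable (\<lambda>i. \<gamma> i / r ^ i) \<and>
     (\<lambda>m. limsup (\<lambda>n. ereal (1 / \<gamma> n * (\<Sum>i=m..n-m. \<gamma> (n - i) * \<gamma> i)))) \<longlonglongrightarrow> 0}"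

definition weight_class_down :: "real \<Rightarrow> (nat \<Rightarrow> real) set" where
  "weight_class_down r = {g \<in> weight_class r.
     \<exists>\<delta>. decseq \<delta> \<and> (\<forall>n. \<delta> n > 0) \<and> (\<lambda>n. g n / \<delta> n) \<longlonglongrightarrow> 1}"

end

theory Submission
  imports Defs
begin

text \<open>
  Up to constant factors the autocovariance function is the autocorrelation
  \<open>\<Sum>j. z j * z (j + n)\<close> of the resolvent \<open>z\<close>
  (\<open>stationary_solution_autocovariance_bounds\<close>), and passing between \<open>b\<close>, \<open>z\<close> and this
  autocorrelation is a question about nonnegative sequences
  (\<open>renewal_autocorrelation_weight_iff\<close>).

  Sequences. That \<open>limsup f/\<gamma>\<close> is positive and finite means that \<open>f\<close> is \<open>O(\<gamma>)\<close> but not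
  \<open>o(\<gamma>)\<close>, so it suffices to carry the properties \<open>O(\<gamma>)\<close> and \<open>o(\<gamma>)\<close> back and forth. Let \<open>u\<close> be
  \<open>\<lambda>\<^sub>1 b\<close>. Since \<open>z 0 = 1\<close>, both \<open>u \<le> z\<close> and \<open>z \<le> const * \<rho>\<close>, which is the easy direction. From
  \<open>u\<close> to \<open>z\<close>, split \<open>z n = \<Sum>i. u i * z (n - i)\<close>: the terms with small \<open>i\<close> reproduce a bound for
  \<open>z/\<gamma>\<close> with a factor close to \<open>\<Sum>i. u i * r\<^sup>-\<^sup>i < 1\<close>, because \<open>\<gamma> (n - i) / \<gamma> n\<close> tends to
  \<open>r\<^sup>-\<^sup>i\<close>; the middle terms are negligible by the convolution condition on \<open>\<gamma>\<close>; the terms with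
  \<open>n - i\<close> small are finitely many multiples of values of \<open>u\<close>. The factor below one makes \<open>z\<close>
  inherit \<open>O(\<gamma>)\<close> and \<open>o(\<gamma>)\<close> from \<open>u\<close>. From \<open>z\<close> to the autocorrelation, \<open>\<gamma>\<close> is comparable to a
  decreasing sequence, so \<open>z (j + n)\<close> is bounded by a multiple of \<open>\<gamma> n\<close> uniformly in \<open>j\<close>, and \<open>z\<close>
  is summable. Finally, if \<open>\<rho>\<close> is \<open>O(\<gamma>)\<close>, then so is \<open>z\<close>, and its generating function converges at
  \<open>1/r\<close>; there the identity \<open>Z = 1 + U Z\<close> for the generating functions forces \<open>U < 1\<close>, which is
  the other half of the condition on \<open>b\<close>.

  Covariance. The innovations \<open>\<nu>(k) = (\<xi>(k) - \<lambda>\<^sub>1) \<varsigma>(k)\<close> are orthogonal, because \<open>\<varsigma>(k)\<close> depends on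
  the noise before \<open>k\<close> only, and resolving \<open>X = \<lambda>\<^sub>1 a + \<nu> + \<lambda>\<^sub>1 b * X\<close> expresses \<open>X\<close> as a constant
  plus the convolution of \<open>z\<close> and \<open>\<nu>\<close>. To have finite sums, the process is first started at a
  time \<open>s\<close> with nothing before \<open>s\<close>. The second moments of its volatility stay between \<open>a\<^sup>2\<close> and a
  constant: \<open>\<Omega> < 1\<close> is what closes their recursion. When \<open>s\<close> tends to \<open>-\<infinity>\<close>, the started
  processes increase, with bounded expectations, to a weakly stationary process that satisfies
  the ARCH equations. By uniqueness it is the given solution, and it inherits the covariance
  bounds.
\<close>

section \<open>Renewal sequences and weights\<close>

text \<open>
  In terms of generating functions, \<open>Z = 1 / (1 - U)\<close>.
\<close>

definition renewal :: "(nat \<Rightarrow> real) \<Rightarrow> (nat \<Rightarrow> real) \<Rightarrow> bool" where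
  "renewal u z \<longleftrightarrow> u 0 = 0 \<and> (\<forall>n. 0 \<le> u n) \<and>
     (\<forall>n. z n = (if n = 0 then 1 else 0) + (\<Sum>i\<le>n. u i * z (n - i)))"

lemma renewal_eq: "renewal u z \<Longrightarrow> z n = (if n = 0 then 1 else 0) + (\<Sum>i\<le>n. u i * z (n - i))"
  unfolding renewal_def by (elim conjE) (rule spec)

lemma renewal_kernel_0: "renewal u z \<Longrightarrow> u 0 = 0"
  unfolding renewal_def by (elim conjE)

lemma renewal_kernel_nonneg: "renewal u z \<Longrightarrow> 0 \<le> u n"
  unfolding renewal_def by (elim conjE) (rule spec)

lemma renewal_nonneg:
  assumes "renewal u z"
  shows "0 \<le> z n"
proof (induction n rule: less_induct)
  case (less n)
  have "0 \<le> u i * z (n - i)" if "i \<le> n" for i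
    using renewal_kernel_0[OF assms] renewal_kernel_nonneg[OF assms, of i] less[of "n - i"] that
    by (cases "i = 0") auto
  then have "0 \<le> (\<Sum>i\<le>n. u i * z (n - i))" by (intro sum_nonneg) auto
  moreover have "z n = (if n = 0 then 1 else 0) + (\<Sum>i\<le>n. u i * z (n - i))"
    by (rule renewal_eq[OF assms(1)])
  ultimately show ?case by simp
qed

lemma renewal_0:
  assumes "renewal u z"
  shows "z 0 = 1"
proof -
  show ?thesis using renewal_eq[OF assms, of 0] renewal_kernel_0[OF assms] by simp
qed

lemma renewal_kernel_le:
  assumes "renewal u z"
  shows "u n \<le> z n"
proof -
  have "u n * z (n - n) \<le> (\<Sum>i\<le>n. u i * z (n - i))"
    using assms renewal_nonneg[OF assms] renewal_kernel_nonneg[OF assms]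
    by (intro member_le_sum) auto
  moreover have "z n = (if n = 0 then 1 else 0) + (\<Sum>i\<le>n. u i * z (n - i))"
    by (rule renewal_eq[OF assms(1)])
  ultimately show ?thesis using renewal_0[OF assms] by simp
qed

text \<open>
  For generating functions, \<open>(1 - U) Y = F\<close> and \<open>(1 - U) Z = 1\<close> give \<open>Y = Z F\<close>.
\<close>

lemma renewal_resolvent:
  assumes "renewal u z" and y: "\<And>n. y n = f n + (\<Sum>i\<le>n. u i * y (n - i))"
  shows "y n = (\<Sum>i\<le>n. z i * f (n - i))"
proof -
  let ?u = "Abs_fps u" and ?z = "Abs_fps z" and ?y = "Abs_fps y" and ?f = "Abs_fps f"
  have zz: "z n = (if n = 0 then 1 else 0) + (\<Sum>i\<le>n. u i * z (n - i))" for n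
    by (rule renewal_eq[OF assms(1)])
  have z: "?z = 1 + ?u * ?z"
    by (rule fps_ext) (subst fps_nth_Abs_fps, subst zz, simp add: fps_mult_nth atLeast0AtMost)
  have yf: "?y = ?f + ?u * ?y"
    by (rule fps_ext) (subst fps_nth_Abs_fps, subst y, simp add: fps_mult_nth atLeast0AtMost)
  have z1: "(1 - ?u) * ?z = 1" using z by (simp add: algebra_simps)
  have y1: "(1 - ?u) * ?y = ?f" using yf by (simp add: algebra_simps)
  have "?y = ((1 - ?u) * ?z) * ?y" using z1 by simp
  also have "\<dots> = ?z * ((1 - ?u) * ?y)" by (simp add: algebra_simps)
  finally have "?y = ?z * ?f" using y1 by simp
  then have "fps_nth ?y n = fps_nth (?z * ?f) n" by simp
  then show ?thesis by (simp add: fps_mult_nth atLeast0AtMost)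
qed

text \<open>
  Evaluating the generating functions at \<open>x\<close> amounts to summing a rescaled renewal sequence, so
  statements on sums also speak about the point \<open>1 / r\<close>.
\<close>

lemma renewal_rescale:
  assumes "renewal u z" "0 \<le> x"
  shows "renewal (\<lambda>n. u n * x ^ n) (\<lambda>n. z n * x ^ n)"
  unfolding renewal_def
proof (intro conjI allI)
  fix n
  have "z n = (if n = 0 then 1 else 0) + (\<Sum>i\<le>n. u i * z (n - i))"
    by (rule renewal_eq[OF assms(1)])
  then have "z n * x ^ n = ((if n = 0 then 1 else 0) + (\<Sum>i\<le>n. u i * z (n - i))) * x ^ n" by simp
  also have "\<dots> = (if n = 0 then 1 else 0) + (\<Sum>i\<le>n. u i * z (n - i) * x ^ n)"
    by (simp add: distrib_right sum_distrib_right)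
  also have "(\<Sum>i\<le>n. u i * z (n - i) * x ^ n) = (\<Sum>i\<le>n. (u i * x ^ i) * (z (n - i) * x ^ (n - i)))"
  proof (rule sum.cong)
    fix i assume "i \<in> {..n}"
    then have "x ^ n = x ^ i * x ^ (n - i)" by (simp flip: power_add)
    then show "u i * z (n - i) * x ^ n = (u i * x ^ i) * (z (n - i) * x ^ (n - i))" by simp
  qed simp
  finally show "z n * x ^ n = (if n = 0 then 1 else 0)
    + (\<Sum>i\<le>n. (u i * x ^ i) * (z (n - i) * x ^ (n - i)))" .
qed (use renewal_kernel_0[OF assms(1)] renewal_kernel_nonneg[OF assms(1)] assms(2) in auto)

text \<open>
  A partial sum \<open>S\<close> of \<open>z\<close> satisfies \<open>S \<le> 1 + (\<Sum>u) S\<close>.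
\<close>

lemma renewal_summable:
  assumes z: "renewal u z" and u: "summable u" and lt: "suminf u < 1"
  shows "summable z"
proof (rule bounded_imp_summable)
  have pu: "0 \<le> u n" and zz: "z n = (if n = 0 then 1 else 0) + (\<Sum>i\<le>n. u i * z (n - i))" for n
    by (rule renewal_kernel_nonneg[OF z], rule renewal_eq[OF z])
  note pz = renewal_nonneg[OF z]
  show "0 \<le> z n" for n by fact
  fix N
  define S where "S = (\<Sum>n\<le>N. z n)"
  have "S = (\<Sum>n\<le>N. (if n = 0 then 1 else 0) + (\<Sum>i\<le>n. u i * z (n - i)))"
    unfolding S_def by (intro sum.cong refl zz)
  also have "\<dots> = (\<Sum>n\<le>N. (if n = 0 then 1 else 0)) + (\<Sum>n\<le>N. \<Sum>i\<le>n. u i * z (n - i))"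
    by (rule sum.distrib)
  also have "(\<Sum>n\<le>N. (if n = 0 then 1 else (0::real))) = 1" by simp
  also have "(\<Sum>n\<le>N. \<Sum>i\<le>n. u i * z (n - i)) = (\<Sum>(i, j)\<in>{(i, j). i + j \<le> N}. u i * z j)"
    by (rule sum.triangle_reindex_eq[symmetric])
  also have "\<dots> \<le> (\<Sum>(i, j)\<in>{..N} \<times> {..N}. u i * z j)"
    using pu pz by (intro sum_mono2) auto
  also have "\<dots> = (\<Sum>i\<le>N. u i) * S"
    unfolding S_def by (simp add: sum_product sum.cartesian_product)
  also have "\<dots> \<le> suminf u * S"
    unfolding S_def using pz pu by (intro mult_right_mono sum_le_suminf u sum_nonneg) auto
  finally have "S * (1 - suminf u) \<le> 1" by (simp add: algebra_simps)
  with lt show "S \<le> 1 / (1 - suminf u)" by (simp add: field_simps)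
qed

text \<open>
  The Cauchy product turns the recursion into \<open>Z = 1 + U Z\<close>. As \<open>Z\<close> is positive and finite, \<open>U < 1\<close>:
  convergence of \<open>z\<close> alone yields the smallness of \<open>u\<close>.
\<close>

lemma renewal_suminf:
  assumes z: "renewal u z" and "summable z"
  shows "summable u" and "suminf z = 1 + suminf u * suminf z" and "suminf u < 1"
proof -
  have pu: "0 \<le> u n" and zz: "z n = (if n = 0 then 1 else 0) + (\<Sum>i\<le>n. u i * z (n - i))" for n
    by (rule renewal_kernel_nonneg[OF z], rule renewal_eq[OF z])
  note pz = renewal_nonneg[OF z]
  show u: "summable u"
    by (rule summable_comparison_test'[OF assms(2)]) (use pu renewal_kernel_le[OF z] in auto)
  have c: "(\<lambda>k. \<Sum>i\<le>k. u i * z (k - i)) sums (suminf u * suminf z)"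
    using pu pz u assms(2) by (intro Cauchy_product_sums) auto
  have d: "(\<lambda>n. if n = 0 then 1 else (0::real)) sums 1"
    using sums_single[of 0 "\<lambda>_. 1::real"] by simp
  have "(\<lambda>n. (if n = 0 then 1 else 0) + (\<Sum>i\<le>n. u i * z (n - i))) = z"
    by (rule ext) (rule zz[symmetric])
  with sums_add[OF d c] have "z sums (1 + suminf u * suminf z)" by (simp only:)
  then show e: "suminf z = 1 + suminf u * suminf z" by (rule sums_unique[symmetric])
  have "(\<Sum>i<1. z i) \<le> suminf z" using pz assms(2) by (intro sum_le_suminf) auto
  then have "suminf z > 0" using renewal_0[OF z] by simp
  moreover have "suminf z * (1 - suminf u) = 1" using e by (simp add: algebra_simps)
  ultimately have "0 < 1 - suminf u" using zero_less_mult_pos[of "suminf z" "1 - suminf u"] by simp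
  then show "suminf u < 1" by simp
qed

lemma weight_shift_ratio:
  assumes "\<gamma> \<in> weight_class r"
  shows "(\<lambda>n. \<gamma> (n - j) / \<gamma> n) \<longlonglongrightarrow> (1 / r) ^ j"
proof -
  have lim: "(\<lambda>n. \<gamma> n / \<gamma> (Suc n)) \<longlonglongrightarrow> 1 / r" and pos: "\<gamma> n > 0" for n
    using assms by (auto simp: weight_class_def)
  have "(\<lambda>n. \<gamma> n / \<gamma> (n + j)) \<longlonglongrightarrow> (1 / r) ^ j"
  proof (induction j)
    case 0
    then show ?case using pos by (simp add: less_imp_neq[THEN not_sym])
  next
    case (Suc j)
    have "(\<lambda>n. \<gamma> (n + j) / \<gamma> (Suc (n + j))) \<longlonglongrightarrow> 1 / r"
      using LIMSEQ_ignore_initial_segment[OF lim, of j] by simp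
    from tendsto_mult[OF Suc this]
    have "(\<lambda>n. \<gamma> n / \<gamma> (n + j) * (\<gamma> (n + j) / \<gamma> (Suc (n + j)))) \<longlonglongrightarrow> (1 / r) ^ Suc j"
      by (simp add: mult.commute)
    moreover have "(\<lambda>n. \<gamma> n / \<gamma> (n + j) * (\<gamma> (n + j) / \<gamma> (Suc (n + j)))) = (\<lambda>n. \<gamma> n / \<gamma> (n + Suc j))"
      using pos by (simp add: fun_eq_iff less_imp_neq[THEN not_sym])
    ultimately show ?case by (simp only:)
  qed
  then have "(\<lambda>n. \<gamma> (n + j - j) / \<gamma> (n + j)) \<longlonglongrightarrow> (1 / r) ^ j" by simp
  then show ?thesis by (rule LIMSEQ_offset)
qed

text \<open>
  The heart of the passage from \<open>u\<close> to \<open>z\<close>. In \<open>z n = \<Sum>i\<le>n. u (n - i) * z i\<close> a bound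
  \<open>z \<le> Z \<gamma>\<close> valid between \<open>m\<close> and \<open>n\<close> reproduces itself with a factor \<open>\<theta>\<close> that may be any number above
  \<open>\<Sum>n. u n / r ^ n\<close>, up to the boundary terms \<open>i < m\<close>. The thresholds for \<open>m\<close> and \<open>n\<close> do not depend on \<open>Z\<close>, which
  allows both the induction over \<open>n\<close> and the iteration over \<open>Z\<close> below.
\<close>

lemma renewal_weight_recursion:
  assumes z: "renewal u z" and \<gamma>: "\<gamma> \<in> weight_class r" and r: "0 < r"
    and K: "\<And>n. u n \<le> K * \<gamma> n"
    and su: "summable (\<lambda>n. u n / r ^ n)" and \<theta>: "(\<Sum>n. u n / r ^ n) < \<theta>"
  shows "\<forall>\<^sub>F m in sequentially. \<forall>\<^sub>F n in sequentially. \<forall>Z\<ge>0.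
    (\<forall>k. m \<le> k \<and> k < n \<longrightarrow> z k \<le> Z * \<gamma> k) \<longrightarrow>
    z n \<le> \<theta> * Z * \<gamma> n + (\<Sum>i<m. z i * u (n - i))"
proof -
  define q where "q = (\<Sum>n. u n / r ^ n)"
  \<comment> \<open>The gap \<open>\<theta> - q\<close> is shared equally by the middle terms and by the error of the ratio limits.\<close>
  define \<epsilon> where "\<epsilon> = (\<theta> - q) / (2 * (K + 1))"
  have pos: "\<gamma> n > 0" for n using \<gamma> by (auto simp: weight_class_def)
  have pu: "0 \<le> u n" and u0: "u 0 = 0" for n
    by (rule renewal_kernel_nonneg[OF z], rule renewal_kernel_0[OF z])
  have zz: "z n = (if n = 0 then 1 else 0) + (\<Sum>i\<le>n. u i * z (n - i))" for n
    by (rule renewal_eq[OF z])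
  note pz = renewal_nonneg[OF z]
  have "0 \<le> K * \<gamma> 0" using K[of 0] pu[of 0] by linarith
  then have K0: "0 \<le> K" using pos[of 0] by (simp add: zero_le_mult_iff)
  have \<epsilon>: "\<epsilon> > 0" using K0 \<theta> by (simp add: \<epsilon>_def q_def)
  have K\<epsilon>: "K * \<epsilon> \<le> (\<theta> - q) / 2"
    using K0 \<theta> by (simp add: \<epsilon>_def q_def field_simps)
  have "(\<lambda>m. limsup (\<lambda>n. ereal (1 / \<gamma> n * (\<Sum>i=m..n-m. \<gamma> (n - i) * \<gamma> i)))) \<longlonglongrightarrow> 0"
    using \<gamma> by (simp add: weight_class_def)
  then have "\<forall>\<^sub>F m in sequentially.
      limsup (\<lambda>n. ereal (1 / \<gamma> n * (\<Sum>i=m..n-m. \<gamma> (n - i) * \<gamma> i))) < ereal \<epsilon>"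
    using \<epsilon> by (intro order_tendstoD(2)) auto
  then show ?thesis
    using eventually_ge_at_top[of 1]
  proof eventually_elim
    case (elim m)
    have mid: "\<forall>\<^sub>F n in sequentially. 1 / \<gamma> n * (\<Sum>i=m..n-m. \<gamma> (n - i) * \<gamma> i) < \<epsilon>"
      using Limsup_lessD[OF elim(1)] by simp
    have "(\<lambda>n. \<Sum>j<m. u j * (\<gamma> (n - j) / \<gamma> n)) \<longlonglongrightarrow> (\<Sum>j<m. u j * (1 / r) ^ j)"
      by (intro tendsto_intros weight_shift_ratio[OF \<gamma>])
    moreover have "(\<Sum>j<m. u j * (1 / r) ^ j) \<le> q"
      unfolding q_def using pu r by (simp add: power_one_over field_simps)
        (intro sum_le_suminf su, auto)
    ultimately have fst: "\<forall>\<^sub>F n in sequentially. (\<Sum>j<m. u j * (\<gamma> (n - j) / \<gamma> n)) < (q + \<theta>) / 2"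
      using \<theta> by (intro order_tendstoD(2)) (auto simp: q_def)
    show ?case
      using mid fst eventually_ge_at_top[of "2 * m"]
    proof eventually_elim
      case n: (elim n)
      show ?case
      proof (intro allI impI)
        fix Z assume Z: "0 \<le> Z" and zZ: "\<forall>k. m \<le> k \<and> k < n \<longrightarrow> z k \<le> Z * \<gamma> k"
        have "z n = (\<Sum>i\<le>n. u i * z (n - i))" using zz[of n] n elim(2) by simp
        also have "\<dots> = (\<Sum>i\<le>n. u (n - i) * z i)"
          by (rule sum.reindex_bij_witness[where i="\<lambda>j. n - j" and j="\<lambda>j. n - j"]) auto
        also have "{..n} = {..<m} \<union> ({m..n-m} \<union> {n-m<..n})"
          using n elim(2) by auto
        also have "(\<Sum>i\<in>\<dots>. u (n - i) * z i) = (\<Sum>i<m. u (n - i) * z i)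
            + ((\<Sum>i=m..n-m. u (n - i) * z i) + (\<Sum>i\<in>{n-m<..n}. u (n - i) * z i))"
          using n elim(2) by (subst sum.union_disjoint; (subst sum.union_disjoint)?) auto
        \<comment> \<open>old values of \<open>z\<close>, both arguments large, recent values of \<open>z\<close>\<close>
        finally have split: "z n = (\<Sum>i<m. z i * u (n - i))
            + ((\<Sum>i=m..n-m. u (n - i) * z i) + (\<Sum>i\<in>{n-m<..n}. u (n - i) * z i))"
          by (simp add: mult.commute)
        have "(\<Sum>i=m..n-m. u (n - i) * z i) \<le> (\<Sum>i=m..n-m. (K * \<gamma> (n - i)) * (Z * \<gamma> i))"
          using zZ n elim(2) pz K pu Z pos K0
          by (intro sum_mono mult_mono) (auto simp: less_imp_le)
        also have "\<dots> = K * Z * (\<Sum>i=m..n-m. \<gamma> (n - i) * \<gamma> i)"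
          by (simp add: sum_distrib_left mult_ac)
        also have "\<dots> \<le> K * Z * (\<epsilon> * \<gamma> n)"
          using n(1) pos[of n] K0 Z by (intro mult_left_mono) (auto simp: field_simps)
        also have "\<dots> = (K * \<epsilon>) * (Z * \<gamma> n)" by simp
        also have "\<dots> \<le> (\<theta> - q) / 2 * (Z * \<gamma> n)"
          using K\<epsilon> Z pos[of n] by (intro mult_right_mono) auto
        finally have middle: "(\<Sum>i=m..n-m. u (n - i) * z i) \<le> (\<theta> - q) / 2 * (Z * \<gamma> n)" .
        have "(\<Sum>i\<in>{n-m<..n}. u (n - i) * z i) \<le> (\<Sum>i\<in>{n-m<..n}. u (n - i) * (Z * \<gamma> i))"
        \<comment> \<open>The hypothesis covers \<open>z i\<close> for \<open>i < n\<close> only; the term \<open>i = n\<close> vanishes with \<open>u 0\<close>.\<close>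
        proof (rule sum_mono)
          fix i assume i: "i \<in> {n-m<..n}"
          show "u (n - i) * z i \<le> u (n - i) * (Z * \<gamma> i)"
          proof (cases "i = n")
            case False
            then show ?thesis using i zZ n pu by (intro mult_left_mono) auto
          qed (simp add: u0)
        qed
        also have "\<dots> = (\<Sum>j<m. u j * (Z * \<gamma> (n - j)))"
          by (rule sum.reindex_bij_witness[where i="\<lambda>j. n - j" and j="\<lambda>j. n - j"])
             (use n elim(2) in auto)
        also have "\<dots> = Z * \<gamma> n * (\<Sum>j<m. u j * (\<gamma> (n - j) / \<gamma> n))"
          using pos[of n] by (simp add: sum_distrib_left field_simps)
        also have "\<dots> \<le> Z * \<gamma> n * ((q + \<theta>) / 2)"
          using n Z pos[of n] by (intro mult_left_mono) auto
        finally have last: "(\<Sum>i\<in>{n-m<..n}. u (n - i) * z i) \<le> Z * \<gamma> n * ((q + \<theta>) / 2)" .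
        have "(\<theta> - q) / 2 * (Z * \<gamma> n) + Z * \<gamma> n * ((q + \<theta>) / 2) = \<theta> * Z * \<gamma> n"
          by (simp add: field_simps)
        then show "z n \<le> \<theta> * Z * \<gamma> n + (\<Sum>i<m. z i * u (n - i))"
          using split middle last by linarith
      qed
    qed
  qed
qed

text \<open>
  With \<open>\<theta> < 1\<close> and boundary terms bounded by \<open>D \<gamma> n\<close>, any constant \<open>C\<close> with \<open>\<theta> C + D \<le> C\<close> that
  works for the finitely many small indices works for all.
\<close>

lemma renewal_weight_bounded:
  assumes z: "renewal u z" and \<gamma>: "\<gamma> \<in> weight_class r" and r: "0 < r"
    and K: "\<And>n. u n \<le> K * \<gamma> n"
    and su: "summable (\<lambda>n. u n / r ^ n)" and lt: "(\<Sum>n. u n / r ^ n) < 1"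
  obtains C where "\<And>n. z n \<le> C * \<gamma> n"
proof -
  have pos: "\<gamma> n > 0" for n using \<gamma> by (auto simp: weight_class_def)
  note pz = renewal_nonneg[OF z]
  have pu: "0 \<le> u n" for n by (rule renewal_kernel_nonneg[OF z])
  have "0 \<le> K * \<gamma> 0" using K[of 0] pu[of 0] by linarith
  then have K0: "0 \<le> K" using pos[of 0] by (simp add: zero_le_mult_iff)
  obtain \<theta> where \<theta>: "(\<Sum>n. u n / r ^ n) < \<theta>" "\<theta> < 1" using lt dense by blast
  obtain m where m: "\<forall>\<^sub>F n in sequentially. \<forall>Z\<ge>0.
      (\<forall>k. m \<le> k \<and> k < n \<longrightarrow> z k \<le> Z * \<gamma> k) \<longrightarrow>
      z n \<le> \<theta> * Z * \<gamma> n + (\<Sum>i<m. z i * u (n - i))"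
    using eventually_happens'[OF sequentially_bot renewal_weight_recursion[OF z \<gamma> r K su \<theta>(1)]] by blast
  define D where "D = K * ((\<Sum>i<m. z i * (1 / r) ^ i) + 1)"
  have D0: "0 \<le> D" unfolding D_def using K0 r pz by (intro mult_nonneg_nonneg add_nonneg_nonneg sum_nonneg) auto
  have "(\<lambda>n. \<Sum>i<m. z i * (\<gamma> (n - i) / \<gamma> n)) \<longlonglongrightarrow> (\<Sum>i<m. z i * (1 / r) ^ i)"
    by (intro tendsto_intros weight_shift_ratio[OF \<gamma>])
  then have "\<forall>\<^sub>F n in sequentially.
      (\<Sum>i<m. z i * (\<gamma> (n - i) / \<gamma> n)) < (\<Sum>i<m. z i * (1 / r) ^ i) + 1"
    by (rule order_tendstoD) simp
  with m have "\<forall>\<^sub>F n in sequentially. (\<forall>Z\<ge>0.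
      (\<forall>k. m \<le> k \<and> k < n \<longrightarrow> z k \<le> Z * \<gamma> k) \<longrightarrow>
      z n \<le> \<theta> * Z * \<gamma> n + (\<Sum>i<m. z i * u (n - i))) \<and>
      (\<Sum>i<m. z i * (\<gamma> (n - i) / \<gamma> n)) < (\<Sum>i<m. z i * (1 / r) ^ i) + 1"
    by (rule eventually_conj)
  then obtain N where N: "\<And>n Z. \<lbrakk>n \<ge> N; 0 \<le> Z; \<And>k. m \<le> k \<Longrightarrow> k < n \<Longrightarrow> z k \<le> Z * \<gamma> k\<rbrakk>
        \<Longrightarrow> z n \<le> \<theta> * Z * \<gamma> n + (\<Sum>i<m. z i * u (n - i))"
    and N': "\<And>n. n \<ge> N \<Longrightarrow> (\<Sum>i<m. z i * (\<gamma> (n - i) / \<gamma> n)) < (\<Sum>i<m. z i * (1 / r) ^ i) + 1"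
    unfolding eventually_sequentially by blast
  define C where "C = (\<Sum>k<N. z k / \<gamma> k) + D / (1 - \<theta>)"
  have C0: "0 \<le> (\<Sum>k<N. z k / \<gamma> k)" using pz pos by (intro sum_nonneg) (auto simp: less_imp_le)
  have C1: "0 \<le> C" using C0 D0 \<theta> by (auto simp: C_def)
  have "D / (1 - \<theta>) \<le> C" using C0 by (simp add: C_def)
  then have C2: "\<theta> * C + D \<le> C" using \<theta> by (simp add: field_simps)
  have "z n \<le> C * \<gamma> n" for n
  proof (induction n rule: less_induct)
    case (less n)
    show ?case
    proof (cases "n < N")
      case True
      then have "z n / \<gamma> n \<le> (\<Sum>k<N. z k / \<gamma> k)"
        using pz pos by (intro member_le_sum) (auto simp: less_imp_le)
      also have "\<dots> \<le> C" using D0 \<theta> by (simp add: C_def)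
      finally show ?thesis using pos[of n] by (simp add: field_simps)
    next
      case False
      have "(\<Sum>i<m. z i * u (n - i)) \<le> (\<Sum>i<m. z i * (K * \<gamma> (n - i)))"
        using K pz by (intro sum_mono mult_left_mono) auto
      also have "\<dots> = K * \<gamma> n * (\<Sum>i<m. z i * (\<gamma> (n - i) / \<gamma> n))"
        using pos[of n] by (simp add: sum_distrib_left field_simps)
      also have "\<dots> \<le> K * \<gamma> n * ((\<Sum>i<m. z i * (1 / r) ^ i) + 1)"
        using N'[of n] False K0 pos[of n] by (intro mult_left_mono) auto
      finally have "(\<Sum>i<m. z i * u (n - i)) \<le> D * \<gamma> n" by (simp add: D_def mult_ac)
      moreover have "z n \<le> \<theta> * C * \<gamma> n + (\<Sum>i<m. z i * u (n - i))"
        using N[of n C] False C1 less by auto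
      ultimately have "z n \<le> (\<theta> * C + D) * \<gamma> n" by (simp add: algebra_simps)
      also have "\<dots> \<le> C * \<gamma> n" using C2 pos[of n] by (intro mult_right_mono) auto
      finally show ?thesis .
    qed
  qed
  then show thesis by (rule that)
qed

text \<open>
  Now the boundary terms are \<open>o(\<gamma>)\<close>, so an eventual bound \<open>z \<le> Z \<gamma>\<close> improves to \<open>z \<le> \<tau> Z \<gamma>\<close>
  for a fixed \<open>\<tau> < 1\<close>, and this can be iterated.
\<close>

lemma renewal_weight_negligible:
  assumes z: "renewal u z" and \<gamma>: "\<gamma> \<in> weight_class r" and r: "0 < r"
    and small: "(\<lambda>n. u n / \<gamma> n) \<longlonglongrightarrow> 0"
    and su: "summable (\<lambda>n. u n / r ^ n)" and lt: "(\<Sum>n. u n / r ^ n) < 1"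
  shows "(\<lambda>n. z n / \<gamma> n) \<longlonglongrightarrow> 0"
proof -
  have pos: "\<gamma> n > 0" for n using \<gamma> by (auto simp: weight_class_def)
  note pz = renewal_nonneg[OF z]
  have pu: "0 \<le> u n" for n by (rule renewal_kernel_nonneg[OF z])
  have "Bseq (\<lambda>n. u n / \<gamma> n)" using small by (intro convergent_imp_Bseq convergentI)
  then obtain K where bound: "\<And>n. norm (u n / \<gamma> n) \<le> K" by (auto simp: Bseq_def)
  have K: "u n \<le> K * \<gamma> n" for n
    using bound[of n] pu[of n] pos[of n] by (simp add: pos_divide_le_eq)
  obtain C where C: "\<And>n. z n \<le> C * \<gamma> n"
    using renewal_weight_bounded[OF z \<gamma> r K su lt] by blast
  have "0 < C * \<gamma> 0" using C[of 0] renewal_0[OF z] by simp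
  then have C0: "0 < C" using pos[of 0] by (simp add: zero_less_mult_iff)
  obtain \<tau> where \<tau>: "(\<Sum>n. u n / r ^ n) < \<tau>" "\<tau> < 1" using lt dense by blast
  obtain \<theta> where \<theta>: "(\<Sum>n. u n / r ^ n) < \<theta>" "\<theta> < \<tau>" using \<tau> dense by blast
  have "0 \<le> (\<Sum>n. u n / r ^ n)" using pu r su by (intro suminf_nonneg) auto
  then have \<tau>0: "0 < \<tau>" using \<tau> by simp
  have step: "\<forall>\<^sub>F n in sequentially. z n \<le> \<tau> * Z * \<gamma> n"
    if Z: "0 < Z" and ev: "\<forall>\<^sub>F n in sequentially. z n \<le> Z * \<gamma> n" for Z
  proof -
    obtain n0 where n0: "\<And>n. n \<ge> n0 \<Longrightarrow> z n \<le> Z * \<gamma> n"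
      using ev by (auto simp: eventually_sequentially)
    have "\<forall>\<^sub>F m in sequentially. (\<forall>\<^sub>F n in sequentially. \<forall>Z\<ge>0.
      (\<forall>k. m \<le> k \<and> k < n \<longrightarrow> z k \<le> Z * \<gamma> k) \<longrightarrow>
      z n \<le> \<theta> * Z * \<gamma> n + (\<Sum>i<m. z i * u (n - i))) \<and> m \<ge> n0"
      by (intro eventually_conj renewal_weight_recursion[OF z \<gamma> r K su \<theta>(1)] eventually_ge_at_top)
    then obtain m where "\<forall>\<^sub>F n in sequentially. \<forall>Z\<ge>0.
      (\<forall>k. m \<le> k \<and> k < n \<longrightarrow> z k \<le> Z * \<gamma> k) \<longrightarrow>
      z n \<le> \<theta> * Z * \<gamma> n + (\<Sum>i<m. z i * u (n - i))" and m: "m \<ge> n0"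
      using eventually_happens'[OF sequentially_bot] by blast
    note this(1)
    then have 1: "\<forall>\<^sub>F n in sequentially. z n \<le> \<theta> * Z * \<gamma> n + (\<Sum>i<m. z i * u (n - i))"
      by (rule eventually_mono) (use n0 Z m in auto)
    have "(\<lambda>n. \<Sum>i<m. z i * (u (n - i) / \<gamma> (n - i) * (\<gamma> (n - i) / \<gamma> n)))
        \<longlonglongrightarrow> (\<Sum>i<m. z i * (0 * (1 / r) ^ i))"
      by (intro tendsto_intros weight_shift_ratio[OF \<gamma>]
          filterlim_compose[OF small filterlim_minus_const_nat_at_top])
    moreover have "u (n - i) / \<gamma> (n - i) * (\<gamma> (n - i) / \<gamma> n) = u (n - i) / \<gamma> n" for n i
      using pos[of "n - i"] by simp
    ultimately have "(\<lambda>n. \<Sum>i<m. z i * (u (n - i) / \<gamma> n)) \<longlonglongrightarrow> 0"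
      by (simp only: mult_zero_left mult_zero_right sum.neutral_const)
    then have 2: "\<forall>\<^sub>F n in sequentially. (\<Sum>i<m. z i * (u (n - i) / \<gamma> n)) < (\<tau> - \<theta>) * Z"
      using Z \<theta> by (intro order_tendstoD) auto
    show ?thesis
      using 1 2
    proof eventually_elim
      case (elim n)
      have "(\<Sum>i<m. z i * u (n - i)) = \<gamma> n * (\<Sum>i<m. z i * (u (n - i) / \<gamma> n))"
        using pos[of n] by (simp add: sum_distrib_left)
      also have "\<dots> \<le> \<gamma> n * ((\<tau> - \<theta>) * Z)"
        using elim pos[of n] by (intro mult_left_mono) auto
      finally show ?case using elim(1) by (simp add: algebra_simps)
    qed
  qed
  have iter: "\<forall>\<^sub>F n in sequentially. z n \<le> \<tau> ^ p * C * \<gamma> n" for p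
  proof (induction p)
    case 0
    then show ?case using C by simp
  next
    case (Suc p)
    have "0 < \<tau> ^ p * C" using \<tau>0 C0 by simp
    from step[OF this Suc] show ?case by (simp add: mult_ac)
  qed
  show ?thesis
  proof (rule order_tendstoI)
    fix e :: real assume "e < 0"
    then show "\<forall>\<^sub>F n in sequentially. e < z n / \<gamma> n"
      using pz pos by (auto intro!: always_eventually simp: less_le_trans[OF _ divide_nonneg_pos])
  next
    fix e :: real assume e: "0 < e"
    have "(\<lambda>p. \<tau> ^ p * C) \<longlonglongrightarrow> 0 * C"
      using \<tau> \<tau>0 by (intro tendsto_intros LIMSEQ_power_zero) auto
    then have "\<forall>\<^sub>F p in sequentially. \<tau> ^ p * C < e" using e by (intro order_tendstoD) auto
    then obtain p where p: "\<tau> ^ p * C < e" using eventually_happens'[OF sequentially_bot] by blast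
    show "\<forall>\<^sub>F n in sequentially. z n / \<gamma> n < e"
      using iter[of p]
    proof eventually_elim
      case (elim n)
      then have "z n / \<gamma> n \<le> \<tau> ^ p * C" using pos[of n] by (simp add: field_simps)
      with p show ?case by simp
    qed
  qed
qed

text \<open>
  Eventually the weight is within a factor two of the decreasing sequence, and the comparison is
  made twice.
\<close>

lemma weight_down_almost_decreasing:
  assumes "\<gamma> \<in> weight_class_down r"
  shows "\<forall>\<^sub>F n in sequentially. \<forall>j. \<gamma> (j + n) \<le> 4 * \<gamma> n"
proof -
  obtain \<delta> where d: "decseq \<delta>" "\<And>n. \<delta> n > 0" "(\<lambda>n. \<gamma> n / \<delta> n) \<longlonglongrightarrow> 1"
    using assms by (auto simp: weight_class_down_def)
  have "\<forall>\<^sub>F n in sequentially. 1 / 2 < \<gamma> n / \<delta> n \<and> \<gamma> n / \<delta> n < 2"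
    using d(3) by (intro eventually_conj order_tendstoD[OF d(3)]) auto
  then obtain N where N: "\<And>n. n \<ge> N \<Longrightarrow> 1 / 2 < \<gamma> n / \<delta> n \<and> \<gamma> n / \<delta> n < 2"
    by (auto simp: eventually_sequentially)
  have "\<gamma> (j + n) \<le> 4 * \<gamma> n" if "n \<ge> N" for n j
  proof -
    have "\<gamma> (j + n) \<le> 2 * \<delta> (j + n)" using N[of "j + n"] that d(2)[of "j + n"] by (simp add: field_simps)
    also have "\<dots> \<le> 2 * \<delta> n" using decseqD[OF d(1), of n "j + n"] by simp
    also have "\<dots> \<le> 4 * \<gamma> n" using N[of n] that d(2)[of n] by (simp add: field_simps)
    finally show ?thesis .
  qed
  then show ?thesis by (auto simp: eventually_sequentially)
qed

lemma summable_autocorrelation: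
  fixes z :: "nat \<Rightarrow> real"
  assumes "\<And>n. 0 \<le> z n" "summable z"
  shows "summable (\<lambda>j. z j * z (j + n))"
proof -
  have "Bseq z" by (rule convergent_imp_Bseq[OF convergentI[OF summable_LIMSEQ_zero[OF assms(2)]]])
  then obtain C where C: "\<And>n. norm (z n) \<le> C" by (auto simp: Bseq_def)
  show ?thesis
    by (rule summable_comparison_test'[OF summable_mult[OF assms(2), of C]])
       (use C assms(1) in \<open>simp add: mult.commute[of C] mult_left_mono\<close>)
qed

text \<open>
  A weight in \<open>weight_class_down\<close> controls all later values of \<open>z\<close> by \<open>\<gamma> n\<close> at once, so that
  the sum over \<open>j\<close> only costs the total mass of \<open>z\<close>.
\<close>

lemma autocorrelation_weight_le:
  assumes \<gamma>: "\<gamma> \<in> weight_class_down r"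
    and z: "\<And>n. 0 \<le> z n" "summable z"
    and Z: "0 \<le> Z" "\<forall>\<^sub>F n in sequentially. z n \<le> Z * \<gamma> n"
  shows "\<forall>\<^sub>F n in sequentially. (\<Sum>j. z j * z (j + n)) \<le> 4 * suminf z * Z * \<gamma> n"
proof -
  obtain N where N: "\<And>n. n \<ge> N \<Longrightarrow> z n \<le> Z * \<gamma> n"
    using Z(2) by (auto simp: eventually_sequentially)
  show ?thesis
    using weight_down_almost_decreasing[OF \<gamma>] eventually_ge_at_top[of N]
  proof eventually_elim
    case (elim n)
    have le: "z (j + n) \<le> 4 * Z * \<gamma> n" for j
    proof -
      have "z (j + n) \<le> Z * \<gamma> (j + n)" using N elim by auto
      also have "\<dots> \<le> Z * (4 * \<gamma> n)" using elim Z(1) by (intro mult_left_mono) auto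
      finally show ?thesis by simp
    qed
    have "(\<Sum>j. z j * z (j + n)) \<le> (\<Sum>j. z j * (4 * Z * \<gamma> n))"
      using z le by (intro suminf_le mult_left_mono summable_autocorrelation summable_mult2) auto
    also have "\<dots> = suminf z * (4 * Z * \<gamma> n)"
      using z by (intro suminf_mult2[symmetric])
    finally show ?case by (simp add: mult_ac)
  qed
qed

text \<open>
  The relations \<open>O\<close> and \<open>o\<close> on the right are easier to carry from one sequence to another than the
  value of a limit superior.
\<close>

lemma limsup_positive_finite_iff:
  fixes f :: "nat \<Rightarrow> real"
  assumes nonneg: "\<forall>\<^sub>F n in sequentially. 0 \<le> f n"
  shows "(\<exists>C>0. limsup (\<lambda>n. ereal (f n)) = ereal C) \<longleftrightarrow>
    (\<exists>K. \<forall>\<^sub>F n in sequentially. f n \<le> K) \<and> \<not> f \<longlonglongrightarrow> 0"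
proof
  assume "\<exists>C>0. limsup (\<lambda>n. ereal (f n)) = ereal C"
  then obtain C where C: "C > 0" "limsup (\<lambda>n. ereal (f n)) = ereal C" by blast
  have "\<forall>\<^sub>F n in sequentially. ereal (f n) < ereal (C + 1)"
    by (rule Limsup_lessD) (simp add: C)
  then have "\<forall>\<^sub>F n in sequentially. f n \<le> C + 1" by eventually_elim simp
  moreover have "\<not> f \<longlonglongrightarrow> 0"
  proof
    assume "f \<longlonglongrightarrow> 0"
    then have "limsup (\<lambda>n. ereal (f n)) = ereal 0"
      by (intro lim_imp_Limsup) auto
    with C show False by simp
  qed
  ultimately show "(\<exists>K. \<forall>\<^sub>F n in sequentially. f n \<le> K) \<and> \<not> f \<longlonglongrightarrow> 0" by blast
next
  assume "(\<exists>K. \<forall>\<^sub>F n in sequentially. f n \<le> K) \<and> \<not> f \<longlonglongrightarrow> 0"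
  then obtain K where K: "\<forall>\<^sub>F n in sequentially. f n \<le> K" and not0: "\<not> f \<longlonglongrightarrow> 0" by blast
  let ?L = "limsup (\<lambda>n. ereal (f n))"
  have "?L \<le> ereal K" by (rule Limsup_bounded) (use K in simp)
  moreover have pos: "0 < ?L"
  proof (rule ccontr)
    assume "\<not> 0 < ?L"
    then have L: "?L \<le> 0" by simp
    have "f \<longlonglongrightarrow> 0"
    proof (rule order_tendstoI)
      fix e :: real assume "e < 0"
      then show "\<forall>\<^sub>F n in sequentially. e < f n" by (auto intro: eventually_mono[OF nonneg])
    next
      fix e :: real assume "0 < e"
      then have "?L < ereal e" using L by (simp add: le_less_trans)
      then show "\<forall>\<^sub>F n in sequentially. f n < e" using Limsup_lessD by fastforce
    qed
    with not0 show False ..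
  qed
  ultimately obtain C where "?L = ereal C" by (cases ?L) auto
  with pos show "\<exists>C>0. ?L = ereal C" by auto
qed

lemma weight_summable:
  assumes "\<gamma> \<in> weight_class r" "0 < r" "\<And>n. 0 \<le> f n"
    and "\<forall>\<^sub>F n in sequentially. f n \<le> K * \<gamma> n"
  shows "summable (\<lambda>n. f n / r ^ n)"
proof (rule summable_comparison_test_ev)
  show "summable (\<lambda>n. K * (\<gamma> n / r ^ n))"
    using assms(1) by (intro summable_mult) (simp add: weight_class_def)
  show "\<forall>\<^sub>F n in sequentially. norm (f n / r ^ n) \<le> K * (\<gamma> n / r ^ n)"
    using assms(4) by eventually_elim (use assms(2,3) in \<open>auto simp: divide_right_mono\<close>)
qed

text \<open>
  Both sides are propagated through \<open>z\<close>: from \<open>u\<close> to \<open>z\<close> by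
  \<open>renewal_weight_bounded\<close> and \<open>renewal_weight_negligible\<close>, from
  \<open>z\<close> to \<open>R\<close> by \<open>autocorrelation_weight_le\<close>, and back by \<open>u n \<le> z n \<le> R n / c\<close>. In the
  backward direction \<open>u\<close> cannot be \<open>o(\<gamma>)\<close>, as then \<open>R\<close> would be.
\<close>

lemma renewal_autocorrelation_weight_iff:
  assumes z: "renewal u z" and \<gamma>: "\<gamma> \<in> weight_class_down r" and r: "0 < r"
    and su: "summable u" and lt: "suminf u < 1" and c: "0 < c" "0 < d"
    and R: "\<And>n. c * (\<Sum>j. z j * z (j + n)) \<le> R n" "\<And>n. R n \<le> d * (\<Sum>j. z j * z (j + n))"
  shows "(summable (\<lambda>n. u n / r ^ n) \<and> (\<Sum>n. u n / r ^ n) < 1 \<and>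
      (\<exists>C>0. limsup (\<lambda>n. ereal (u n / \<gamma> n)) = ereal C))
    \<longleftrightarrow> (\<exists>C>0. limsup (\<lambda>n. ereal (R n / \<gamma> n)) = ereal C)"
    (is "?S \<and> ?q < 1 \<and> ?A \<longleftrightarrow> ?B")
proof -
  have \<gamma>': "\<gamma> \<in> weight_class r" using \<gamma> by (simp add: weight_class_down_def)
  then have pos: "\<gamma> n > 0" for n by (auto simp: weight_class_def)
  note pz = renewal_nonneg[OF z]
  have pu: "0 \<le> u n" for n by (rule renewal_kernel_nonneg[OF z])
  note sz = renewal_summable[OF z su lt]
  have Sz: "0 \<le> suminf z" using pz sz by (intro suminf_nonneg) auto
  have zR: "c * z n \<le> R n" for n
  proof -
    have "(\<Sum>j<1. z j * z (j + n)) \<le> (\<Sum>j. z j * z (j + n))"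
      using pz sz by (intro sum_le_suminf summable_autocorrelation) auto
    then have "c * z n \<le> c * (\<Sum>j. z j * z (j + n))" using c renewal_0[OF z] by simp
    with R(1)[of n] show ?thesis by simp
  qed
  have R0: "0 \<le> R n" for n
    using order_trans[OF mult_nonneg_nonneg[OF less_imp_le[OF c(1)] pz] zR] .
  have uR: "u n \<le> R n / c" for n
  proof -
    have "c * u n \<le> R n"
      using order_trans[OF mult_left_mono[OF renewal_kernel_le[OF z] less_imp_le[OF c(1)]] zR] .
    then show ?thesis using c by (simp add: field_simps)
  qed
  have zO_RO: "\<exists>K. \<forall>\<^sub>F n in sequentially. R n / \<gamma> n \<le> K" if "\<forall>\<^sub>F n in sequentially. z n \<le> Z * \<gamma> n" "0 \<le> Z" for Z
  proof
    show "\<forall>\<^sub>F n in sequentially. R n / \<gamma> n \<le> d * (4 * suminf z * Z)"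
      using autocorrelation_weight_le[OF \<gamma> pz sz that(2,1)]
    proof eventually_elim
      case (elim n)
      have "R n \<le> d * (4 * suminf z * Z * \<gamma> n)"
        using order_trans[OF R(2) mult_left_mono[OF elim less_imp_le[OF c(2)]]] .
      then show ?case using pos[of n] by (simp add: field_simps)
    qed
  qed
  have zo_Ro: "(\<lambda>n. R n / \<gamma> n) \<longlonglongrightarrow> 0" if "(\<lambda>n. z n / \<gamma> n) \<longlonglongrightarrow> 0"
  proof (rule order_tendstoI)
    fix e :: real assume "e < 0"
    then show "\<forall>\<^sub>F n in sequentially. e < R n / \<gamma> n"
      using R0 pos by (auto intro!: always_eventually simp: less_le_trans[OF _ divide_nonneg_pos])
  next
    fix e :: real assume e: "0 < e"
    \<comment> \<open>One is added to the sum of \<open>z\<close> to make the final inequality strict.\<close>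
    define Z where "Z = e / (d * (4 * (suminf z + 1)))"
    have Z: "0 < Z" using e c Sz by (simp add: Z_def)
    have Ze: "d * (4 * (suminf z + 1) * Z) = e" using c Sz by (simp add: Z_def)
    have "d * (4 * suminf z * Z) < d * (4 * (suminf z + 1) * Z)"
      using c Z by (intro mult_strict_left_mono mult_strict_right_mono) auto
    with Ze have lt_e: "d * (4 * suminf z * Z) < e" by simp
    have "\<forall>\<^sub>F n in sequentially. z n / \<gamma> n < Z" using that Z by (rule order_tendstoD)
    then have "\<forall>\<^sub>F n in sequentially. z n \<le> Z * \<gamma> n"
      by eventually_elim (use pos in \<open>simp add: field_simps less_imp_le\<close>)
    from autocorrelation_weight_le[OF \<gamma> pz sz less_imp_le[OF Z] this]
    show "\<forall>\<^sub>F n in sequentially. R n / \<gamma> n < e"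
    proof eventually_elim
      case (elim n)
      have "R n \<le> d * (4 * suminf z * Z * \<gamma> n)"
        using order_trans[OF R(2) mult_left_mono[OF elim less_imp_le[OF c(2)]]] .
      also have "\<dots> = d * (4 * suminf z * Z) * \<gamma> n" by simp
      also have "\<dots> < e * \<gamma> n" using lt_e pos[of n] by (rule mult_strict_right_mono)
      finally show ?case using pos[of n] by (simp add: field_simps)
    qed
  qed
  have Aiff: "?A \<longleftrightarrow> (\<exists>K. \<forall>\<^sub>F n in sequentially. u n / \<gamma> n \<le> K) \<and> \<not> (\<lambda>n. u n / \<gamma> n) \<longlonglongrightarrow> 0"
    using pu pos by (intro limsup_positive_finite_iff) (auto simp: less_imp_le)
  have Biff: "?B \<longleftrightarrow> (\<exists>K. \<forall>\<^sub>F n in sequentially. R n / \<gamma> n \<le> K) \<and> \<not> (\<lambda>n. R n / \<gamma> n) \<longlonglongrightarrow> 0"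
    using R0 pos by (intro limsup_positive_finite_iff) (auto simp: less_imp_le)
  have Ro_uo: "(\<lambda>n. u n / \<gamma> n) \<longlonglongrightarrow> 0" if "(\<lambda>n. R n / \<gamma> n) \<longlonglongrightarrow> 0"
  proof (rule tendsto_sandwich)
    show "\<forall>\<^sub>F n in sequentially. u n / \<gamma> n \<le> R n / \<gamma> n / c"
      using divide_right_mono[OF uR less_imp_le[OF pos]] by (auto intro!: always_eventually simp: mult.commute)
    show "\<forall>\<^sub>F n in sequentially. 0 \<le> u n / \<gamma> n"
      using pu pos by (auto intro!: always_eventually simp: less_imp_le)
    show "(\<lambda>n. R n / \<gamma> n / c) \<longlonglongrightarrow> 0" using tendsto_divide[OF that tendsto_const, of c] c by simp
  qed (rule tendsto_const)
  show ?thesis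
  proof
    assume L: "?S \<and> ?q < 1 \<and> ?A"
    then obtain K where K: "\<forall>\<^sub>F n in sequentially. u n / \<gamma> n \<le> K"
      and not0: "\<not> (\<lambda>n. u n / \<gamma> n) \<longlonglongrightarrow> 0" unfolding Aiff by blast
    have "Bfun (\<lambda>n. u n / \<gamma> n) sequentially"
      using K by (intro BfunI[where K=K], eventually_elim) (use pu pos in \<open>auto simp: abs_of_nonneg less_imp_le\<close>)
    then have "Bseq (\<lambda>n. u n / \<gamma> n)" .
    then obtain K' where bound: "\<And>n. norm (u n / \<gamma> n) \<le> K'" by (auto simp: Bseq_def)
    have K': "u n \<le> K' * \<gamma> n" for n
      using bound[of n] pu[of n] pos[of n] by (simp add: pos_divide_le_eq)
    obtain C where C: "\<And>n. z n \<le> C * \<gamma> n"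
      using renewal_weight_bounded[OF z \<gamma>' r K'] L by blast
    have "0 < C * \<gamma> 0" using C[of 0] renewal_0[OF z] by simp
    then have C0: "0 \<le> C" using pos[of 0] by (simp add: zero_less_mult_iff less_imp_le)
    show ?B unfolding Biff
      using zO_RO[of C] C C0 not0 Ro_uo by auto
  next
    assume ?B
    then obtain K where K: "\<forall>\<^sub>F n in sequentially. R n / \<gamma> n \<le> K"
      and not0: "\<not> (\<lambda>n. R n / \<gamma> n) \<longlonglongrightarrow> 0" unfolding Biff by blast
    have zO: "\<forall>\<^sub>F n in sequentially. z n \<le> K / c * \<gamma> n"
      using K
    proof eventually_elim
      case (elim n)
      then show ?case using zR[of n] pos[of n] c by (simp add: field_simps)
    qed
    have "summable (\<lambda>n. z n / r ^ n)" using weight_summable[OF \<gamma>' r pz zO] .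
    then have sz': "summable (\<lambda>n. z n * (1 / r) ^ n)" by (simp add: power_one_over field_simps)
    have "renewal (\<lambda>n. u n * (1 / r) ^ n) (\<lambda>n. z n * (1 / r) ^ n)"
      using z r by (intro renewal_rescale) auto
    from renewal_suminf(1,3)[OF this sz'] have S: ?S and q: "?q < 1"
      by (simp_all add: power_one_over field_simps)
    have "\<not> (\<lambda>n. u n / \<gamma> n) \<longlonglongrightarrow> 0"
      using renewal_weight_negligible[OF z \<gamma>' r _ S q] zo_Ro not0 by blast
    moreover have "\<forall>\<^sub>F n in sequentially. u n / \<gamma> n \<le> K / c"
      using zO by eventually_elim
        (use renewal_kernel_le[OF z] pos in \<open>auto simp: pos_divide_le_eq intro: order_trans\<close>)
    ultimately show "?S \<and> ?q < 1 \<and> ?A" unfolding Aiff using S q by blast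
  qed
qed

section \<open>Monotone limits and square integrable random variables\<close>

text \<open>
  By monotone convergence the supremum has a finite integral in \<open>[0, \<infinity>]\<close>, hence it is finite almost
  everywhere.
\<close>

lemma AE_convergent_of_bounded_integrals:
  fixes f :: "nat \<Rightarrow> 'a \<Rightarrow> real"
  assumes int: "\<And>n. integrable M (f n)" and mono: "AE x in M. mono (\<lambda>n. f n x)"
    and nonneg: "\<And>n. AE x in M. 0 \<le> f n x" and bound: "\<And>n. (\<integral>x. f n x \<partial>M) \<le> C"
  shows "AE x in M. convergent (\<lambda>n. f n x)"
proof -
  have [measurable]: "f n \<in> borel_measurable M" for n using int by auto
  have "(\<integral>\<^sup>+ x. (SUP n. ennreal (f n x)) \<partial>M) = (SUP n. \<integral>\<^sup>+ x. ennreal (f n x) \<partial>M)"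
    by (intro nn_integral_monotone_convergence_SUP_AE)
      (use mono in \<open>auto simp: mono_def intro!: ennreal_leI\<close>)
  also have "\<dots> = (SUP n. ennreal (\<integral>x. f n x \<partial>M))"
    by (intro SUP_cong refl nn_integral_eq_integral int nonneg)
  also have "\<dots> \<le> ennreal C" by (intro SUP_least ennreal_leI bound)
  finally have "(\<integral>\<^sup>+ x. (SUP n. ennreal (f n x)) \<partial>M) \<noteq> \<infinity>"
    using ennreal_less_top[of C] by (auto simp: top_unique)
  then have "AE x in M. (SUP n. ennreal (f n x)) \<noteq> \<infinity>"
    by (intro nn_integral_noteq_infinite) auto
  then show ?thesis using mono
  proof eventually_elim
    case (elim x)
    define K where "K = (SUP n. ennreal (f n x))"
    have "K < top" using elim(1) by (simp only: K_def less_top infinity_ennreal_def simp_thms)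
    have "f n x \<le> enn2real K" for n
    proof -
      have "ennreal (f n x) \<le> K" unfolding K_def by (intro SUP_upper) auto
      also have "K = ennreal (enn2real K)" using \<open>K < top\<close> by (rule ennreal_enn2real[symmetric])
      finally show ?thesis by (simp add: ennreal_le_iff)
    qed
    then show ?case using incseq_convergent[of "\<lambda>n. f n x"] elim(2) by (blast intro: convergentI)
  qed
qed

definition square_integrable :: "'a measure \<Rightarrow> ('a \<Rightarrow> real) \<Rightarrow> bool" where
  "square_integrable M f \<longleftrightarrow> f \<in> borel_measurable M \<and> integrable M (\<lambda>x. (f x)\<^sup>2)"

lemma square_integrable_mult:
  assumes "square_integrable M f" "square_integrable M g"
  shows "integrable M (\<lambda>x. f x * g x)"
proof (rule Bochner_Integration.integrable_bound)
  show "integrable M (\<lambda>x. (f x)\<^sup>2 + (g x)\<^sup>2)" using assms by (auto simp: square_integrable_def)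
  show "(\<lambda>x. f x * g x) \<in> borel_measurable M" using assms by (auto simp: square_integrable_def)
  have "\<bar>u * v\<bar> \<le> u\<^sup>2 + v\<^sup>2" for u v :: real
  proof -
    have "2 * \<bar>u * v\<bar> \<le> u\<^sup>2 + v\<^sup>2"
      using zero_le_power2[of "\<bar>u\<bar> - \<bar>v\<bar>"] by (simp add: power2_diff abs_mult)
    then show ?thesis using sum_power2_ge_zero[of u v] by linarith
  qed
  then show "AE x in M. norm (f x * g x) \<le> norm ((f x)\<^sup>2 + (g x)\<^sup>2)"
    by (intro AE_I2) simp
qed

lemma square_integrable_add:
  assumes "square_integrable M f" "square_integrable M g"
  shows "square_integrable M (\<lambda>x. f x + g x)"
  unfolding square_integrable_def power2_sum
proof (intro conjI Bochner_Integration.integrable_add)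
  show "integrable M (\<lambda>x. 2 * f x * g x)"
    using integrable_mult_right[OF square_integrable_mult[OF assms], of 2] by (simp add: mult.assoc)
qed (use assms in \<open>auto simp: square_integrable_def\<close>)

lemma square_integrable_cmult:
  assumes "square_integrable M f"
  shows "square_integrable M (\<lambda>x. c * f x)"
  using assms by (auto simp: square_integrable_def power_mult_distrib)

lemma (in finite_measure) square_integrable_const: "square_integrable M (\<lambda>x. c)"
  by (auto simp: square_integrable_def)

lemma (in finite_measure) square_integrable_sum:
  assumes "\<And>i. i \<in> I \<Longrightarrow> square_integrable M (f i)"
  shows "square_integrable M (\<lambda>x. \<Sum>i\<in>I. f i x)"
  using assms
  by (induction I rule: infinite_finite_induct) (auto intro: square_integrable_const square_integrable_add)

lemma (in finite_measure) square_integrable_integrable: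
  "square_integrable M f \<Longrightarrow> integrable M f"
  by (auto simp: square_integrable_def intro: square_integrable_imp_integrable)

lemma (in prob_space) cov_eq_expectation:
  assumes f: "square_integrable M f" and g: "square_integrable M g"
  shows "cov M f g = expectation (\<lambda>x. f x * g x) - expectation f * expectation g"
proof -
  note [simp] = square_integrable_integrable[OF f] square_integrable_integrable[OF g]
    square_integrable_mult[OF f g]
  have "(\<lambda>x. (f x - expectation f) * (g x - expectation g)) =
      (\<lambda>x. f x * g x - expectation g * f x - expectation f * g x + expectation f * expectation g)"
    by (simp add: fun_eq_iff algebra_simps)
  then show ?thesis by (simp add: cov_def prob_space)
qed

lemma cov_commute: "cov M f g = cov M g f"
  by (simp add: cov_def mult.commute)

section \<open>The ARCH recursion started at a finite time\<close>

text \<open>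
  The value at time \<open>s + p\<close> of the ARCH recursion along a noise path \<open>x\<close>, with nothing before time \<open>s\<close>.
  It is a functional of a deterministic path, so that its dependence on the past of the noise
  can be expressed by measurability on a product space.
\<close>

fun arch_from :: "real \<Rightarrow> (nat \<Rightarrow> real) \<Rightarrow> (int \<Rightarrow> real) \<Rightarrow> int \<Rightarrow> nat \<Rightarrow> real" where
  "arch_from a b x s p = x (s + int p) * (a + (\<Sum>i<p. b (p - i) * arch_from a b x s i))"

declare arch_from.simps [simp del]

definition vol_from :: "real \<Rightarrow> (nat \<Rightarrow> real) \<Rightarrow> (int \<Rightarrow> real) \<Rightarrow> int \<Rightarrow> nat \<Rightarrow> real" where
  "vol_from a b x s p = a + (\<Sum>i<p. b (p - i) * arch_from a b x s i)"

lemma arch_from_eq: "arch_from a b x s p = x (s + int p) * vol_from a b x s p"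
  by (subst arch_from.simps) (simp add: vol_from_def)

lemma arch_from_cong:
  assumes "\<And>i. i \<le> p \<Longrightarrow> x (s + int i) = y (s + int i)"
  shows "arch_from a b x s p = arch_from a b y s p"
  using assms
proof (induction p rule: less_induct)
  case (less p)
  have "(\<Sum>i<p. b (p - i) * arch_from a b x s i) = (\<Sum>i<p. b (p - i) * arch_from a b y s i)"
    using less by (intro sum.cong) auto
  then show ?case using less.prems[of p] by (subst (1 2) arch_from.simps) simp
qed

lemma arch_from_measurable:
  assumes "\<And>i. i \<le> p \<Longrightarrow> X (s + int i) \<in> borel_measurable N"
  shows "(\<lambda>\<omega>. arch_from a b (\<lambda>k. X k \<omega>) s p) \<in> borel_measurable N"
  using assms
proof (induction p rule: less_induct)
  case (less p)
  have "(\<lambda>\<omega>. X (s + int p) \<omega> * (a + (\<Sum>i<p. b (p - i) * arch_from a b (\<lambda>k. X k \<omega>) s i)))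
      \<in> borel_measurable N"
    using less by (intro borel_measurable_times borel_measurable_add borel_measurable_sum
        borel_measurable_const) auto
  then show ?case by (subst arch_from.simps)
qed

lemma arch_from_nonneg:
  assumes "\<And>k. 0 \<le> x k" "0 \<le> a" "\<And>j. j \<ge> 1 \<Longrightarrow> 0 \<le> b j"
  shows "0 \<le> arch_from a b x s p"
proof (induction p rule: less_induct)
  case (less p)
  then have "0 \<le> (\<Sum>i<p. b (p - i) * arch_from a b x s i)"
    using assms(3) by (intro sum_nonneg mult_nonneg_nonneg) auto
  then show ?case using assms(1,2) by (subst arch_from.simps) auto
qed

text \<open>
  The process started one step earlier receives the additional nonnegative input \<open>b (p + 1) * x (s - 1) * a\<close>
  and otherwise follows the same recursion.
\<close>

lemma arch_from_earlier_start:
  assumes x: "\<And>k. 0 \<le> x k" and a: "0 \<le> a" and b: "\<And>j. j \<ge> 1 \<Longrightarrow> 0 \<le> b j"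
  shows "arch_from a b x s p \<le> arch_from a b x (s - 1) (Suc p)"
proof (induction p rule: less_induct)
  case (less p)
  have "(\<Sum>i<p. b (p - i) * arch_from a b x s i) \<le> (\<Sum>i<p. b (p - i) * arch_from a b x (s - 1) (Suc i))"
    using less b by (intro sum_mono mult_left_mono) auto
  also have "\<dots> \<le> (\<Sum>i<Suc p. b (Suc p - i) * arch_from a b x (s - 1) i)"
    using b[of "Suc p"] arch_from_nonneg[OF x a b, where s = "s - 1" and p = 0]
    by (subst sum.lessThan_Suc_shift) simp
  finally have "x (s + int p) * (a + (\<Sum>i<p. b (p - i) * arch_from a b x s i)) \<le>
      x (s + int p) * (a + (\<Sum>i<Suc p. b (Suc p - i) * arch_from a b x (s - 1) i))"
    using x by (intro mult_left_mono add_left_mono) auto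
  then show ?case
    by (subst arch_from.simps, subst (2) arch_from.simps) (simp add: algebra_simps)
qed

text \<open>
  The coordinates before \<open>k\<close> form a space of extensional functions, so a functional of whole paths has
  to be factored through the restriction.
\<close>

definition depends_on_past :: "int \<Rightarrow> ((int \<Rightarrow> real) \<Rightarrow> real) \<Rightarrow> bool" where
  "depends_on_past k G \<longleftrightarrow>
     G \<in> borel_measurable (PiM {..<k} (\<lambda>_. borel)) \<and> (\<forall>x. G (restrict x {..<k}) = G x)"

lemma depends_on_past_arch_from:
  assumes "s + int i < k"
  shows "depends_on_past k (\<lambda>x. arch_from a b x s i)"
  unfolding depends_on_past_def
proof (intro conjI allI)
  show "(\<lambda>x. arch_from a b x s i) \<in> borel_measurable (PiM {..<k} (\<lambda>_. borel))"
    using arch_from_measurable[of i "\<lambda>j x. x j" s "PiM {..<k} (\<lambda>_. borel)"] assms by auto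
  show "arch_from a b (restrict x {..<k}) s i = arch_from a b x s i" for x
    using assms by (intro arch_from_cong) auto
qed

lemma depends_on_past_const: "depends_on_past k (\<lambda>x. c)"
  by (auto simp: depends_on_past_def)

lemma depends_on_past_coordinate: "i < k \<Longrightarrow> depends_on_past k (\<lambda>x. x i)"
  by (auto simp: depends_on_past_def)

lemma depends_on_past_add:
  "depends_on_past k F \<Longrightarrow> depends_on_past k G \<Longrightarrow> depends_on_past k (\<lambda>x. F x + G x)"
  by (auto simp: depends_on_past_def)

lemma depends_on_past_mult:
  "depends_on_past k F \<Longrightarrow> depends_on_past k G \<Longrightarrow> depends_on_past k (\<lambda>x. F x * G x)"
  by (auto simp: depends_on_past_def)

lemma depends_on_past_sum:
  "(\<And>i. i \<in> I \<Longrightarrow> depends_on_past k (F i)) \<Longrightarrow> depends_on_past k (\<lambda>x. \<Sum>i\<in>I. F i x)"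
  unfolding depends_on_past_def by (auto intro!: borel_measurable_sum)

lemma depends_on_past_vol_from:
  assumes "s + int p \<le> k"
  shows "depends_on_past k (\<lambda>x. vol_from a b x s p)"
  unfolding vol_from_def using assms
  by (intro depends_on_past_add depends_on_past_sum depends_on_past_mult depends_on_past_const
      depends_on_past_arch_from) auto

lemma (in prob_space) indep_var_past:
  fixes \<xi> :: "int \<Rightarrow> 'a \<Rightarrow> real"
  assumes ind: "indep_vars (\<lambda>_. borel) \<xi> UNIV" and \<phi>: "\<phi> \<in> borel_measurable borel"
    and G: "depends_on_past k G"
  shows "indep_var borel (\<lambda>\<omega>. \<phi> (\<xi> k \<omega>) :: real) borel (\<lambda>\<omega>. G (\<lambda>i. \<xi> i \<omega>))"
proof -
  have "indep_var
      borel ((\<lambda>f. \<phi> (f k)) \<circ> (\<lambda>\<omega>. restrict (\<lambda>i. \<xi> i \<omega>) {k}))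
      borel (G \<circ> (\<lambda>\<omega>. restrict (\<lambda>i. \<xi> i \<omega>) {..<k}))"
  proof (rule indep_var_compose[OF indep_var_restrict[OF ind]])
    show "(\<lambda>f. \<phi> (f k)) \<in> borel_measurable (PiM {k} (\<lambda>_. borel))"
      by (rule measurable_compose[OF _ \<phi>]) simp
    show "G \<in> borel_measurable (PiM {..<k} (\<lambda>_. borel))" using G by (simp add: depends_on_past_def)
  qed auto
  then show ?thesis using G by (simp add: depends_on_past_def comp_def)
qed

section \<open>Second moments of the started processes\<close>

lemma renewal_arch_z:
  assumes "0 \<le> l" "\<And>j. j \<ge> 1 \<Longrightarrow> 0 \<le> b j"
  shows "renewal (\<lambda>j. if j = 0 then 0 else l * b j) (arch_z l b)"
  unfolding renewal_def
proof (intro conjI allI)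
  fix n
  show "arch_z l b n = (if n = 0 then 1 else 0)
      + (\<Sum>i\<le>n. (if i = 0 then 0 else l * b i) * arch_z l b (n - i))"
  proof (cases n)
    case (Suc m)
    have "(\<Sum>i\<le>n. (if i = 0 then 0 else l * b i) * arch_z l b (n - i))
        = (\<Sum>i\<in>{1..n}. (if i = 0 then 0 else l * b i) * arch_z l b (n - i))"
      by (rule sum.mono_neutral_right) auto
    also have "\<dots> = (\<Sum>j<n. l * b (n - j) * arch_z l b j)"
      by (rule sum.reindex_bij_witness[where i="\<lambda>j. n - j" and j="\<lambda>j. n - j"]) auto
    also have "\<dots> = arch_z l b n" by (simp add: Suc sum_distrib_left mult.assoc del: sum.lessThan_Suc)
    finally show ?thesis using Suc by simp
  qed simp
qed (use assms in auto)

declare arch_z.simps(2) [simp del]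

locale arch_noise = prob_space M for M :: "'a measure" +
  fixes \<xi> :: "int \<Rightarrow> 'a \<Rightarrow> real" and a :: real and b :: "nat \<Rightarrow> real"
  assumes iid: "iid M \<xi>"
    and noise_nonneg: "\<And>k. AE \<omega> in M. 0 \<le> \<xi> k \<omega>"
    and noise_square: "integrable M (\<lambda>\<omega>. (\<xi> 0 \<omega>)\<^sup>2)"
    and mean_pos: "0 < arch_lambda1 M \<xi>"
    and a_pos: "0 < a"
    and b_nonneg: "\<And>j. j \<ge> 1 \<Longrightarrow> 0 \<le> b j"
    and b_summable: "summable (\<lambda>j. b (Suc j))"
    and subcritical: "arch_lambda1 M \<xi> * arch_B b < 1"
    and z2_summable: "summable (\<lambda>j. (arch_z (arch_lambda1 M \<xi>) b (Suc j))\<^sup>2)"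
    and Omega_lt_1: "arch_Omega M b \<xi> < 1"
begin

abbreviation l :: real where "l \<equiv> arch_lambda1 M \<xi>"
abbreviation z :: "nat \<Rightarrow> real" where "z \<equiv> arch_z l b"
abbreviation u :: "nat \<Rightarrow> real" where "u \<equiv> \<lambda>j. if j = 0 then 0 else l * b j"
abbreviation noise_var :: real where "noise_var \<equiv> variance (\<xi> 0)"
abbreviation noise_path :: "'a \<Rightarrow> int \<Rightarrow> real" where "noise_path \<omega> \<equiv> \<lambda>k. \<xi> k \<omega>"

text \<open>
  The prefix \<open>start_\<close> marks the quantities of the process started at time \<open>s\<close>, evaluated at time
  \<open>s + p\<close>.
\<close>

definition start_X :: "int \<Rightarrow> nat \<Rightarrow> 'a \<Rightarrow> real" where
  "start_X s p \<omega> = arch_from a b (noise_path \<omega>) s p"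

definition start_vol :: "int \<Rightarrow> nat \<Rightarrow> 'a \<Rightarrow> real" where
  "start_vol s p \<omega> = vol_from a b (noise_path \<omega>) s p"

definition \<nu> :: "int \<Rightarrow> nat \<Rightarrow> 'a \<Rightarrow> real" where
  "\<nu> s p \<omega> = (\<xi> (s + int p) \<omega> - l) * start_vol s p \<omega>"

lemma renewal_z: "renewal u z"
  using renewal_arch_z[of l b] mean_pos b_nonneg by simp

lemma z_nonneg: "0 \<le> z n"
  by (rule renewal_nonneg[OF renewal_z])

lemma u_suminf: "summable u" "suminf u < 1"
proof -
  have "(\<lambda>j. u (Suc j)) sums (l * arch_B b)"
    using summable_sums[OF b_summable] by (auto simp: arch_B_def intro: sums_mult)
  then have "u sums (l * arch_B b)" by (subst (asm) sums_Suc_iff) simp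
  then show "summable u" "suminf u < 1" using subcritical sums_unique[of u] by (auto simp: sums_iff)
qed

lemma z_summable: "summable z"
  by (rule renewal_summable[OF renewal_z u_suminf])

lemma noise_indep: "indep_vars (\<lambda>_. borel) \<xi> UNIV"
  using iid unfolding iid_def by (rule conjunct1)

lemma noise_measurable [measurable]: "\<xi> k \<in> borel_measurable M"
  using noise_indep by (simp add: indep_vars_def)

lemma noise_distr: "distr M borel (\<xi> k) = distr M borel (\<xi> 0)"
  using iid unfolding iid_def by (elim conjE) (rule spec)

lemma noise_expectation:
  assumes [measurable]: "\<phi> \<in> borel_measurable borel"
  shows "expectation (\<lambda>\<omega>. \<phi> (\<xi> k \<omega>) :: real) = expectation (\<lambda>\<omega>. \<phi> (\<xi> 0 \<omega>))"
    and "integrable M (\<lambda>\<omega>. \<phi> (\<xi> k \<omega>)) \<longleftrightarrow> integrable M (\<lambda>\<omega>. \<phi> (\<xi> 0 \<omega>))"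
proof -
  have "integral\<^sup>L (distr M borel (\<xi> k)) \<phi> = integral\<^sup>L (distr M borel (\<xi> 0)) \<phi>"
    by (simp only: noise_distr[of k])
  then show "expectation (\<lambda>\<omega>. \<phi> (\<xi> k \<omega>)) = expectation (\<lambda>\<omega>. \<phi> (\<xi> 0 \<omega>))"
    by (simp add: integral_distr)
  have "integrable (distr M borel (\<xi> k)) \<phi> \<longleftrightarrow> integrable (distr M borel (\<xi> 0)) \<phi>"
    by (simp only: noise_distr[of k])
  then show "integrable M (\<lambda>\<omega>. \<phi> (\<xi> k \<omega>)) \<longleftrightarrow> integrable M (\<lambda>\<omega>. \<phi> (\<xi> 0 \<omega>))"
    by (simp add: integrable_distr_eq)
qed

text \<open>
  Every moment of the started processes reduces to this case of independence, with the present noise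
  on one side and a functional of the past on the other.
\<close>

lemma noise_past:
  assumes \<phi>: "\<phi> \<in> borel_measurable borel" and G: "depends_on_past k G"
    and int\<phi>: "integrable M (\<lambda>\<omega>. \<phi> (\<xi> 0 \<omega>) :: real)" and intG: "integrable M (\<lambda>\<omega>. G (noise_path \<omega>))"
  shows "integrable M (\<lambda>\<omega>. \<phi> (\<xi> k \<omega>) * G (noise_path \<omega>))"
    and "expectation (\<lambda>\<omega>. \<phi> (\<xi> k \<omega>) * G (noise_path \<omega>)) =
      expectation (\<lambda>\<omega>. \<phi> (\<xi> 0 \<omega>)) * expectation (\<lambda>\<omega>. G (noise_path \<omega>))"
proof -
  have i: "integrable M (\<lambda>\<omega>. \<phi> (\<xi> k \<omega>))" using int\<phi> noise_expectation(2)[OF \<phi>] by simp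
  note ind = indep_var_past[OF noise_indep \<phi> G]
  show "integrable M (\<lambda>\<omega>. \<phi> (\<xi> k \<omega>) * G (noise_path \<omega>))"
    by (rule indep_var_integrable[OF ind i intG])
  show "expectation (\<lambda>\<omega>. \<phi> (\<xi> k \<omega>) * G (noise_path \<omega>)) =
      expectation (\<lambda>\<omega>. \<phi> (\<xi> 0 \<omega>)) * expectation (\<lambda>\<omega>. G (noise_path \<omega>))"
    using indep_var_lebesgue_integral[OF ind i intG] noise_expectation(1)[OF \<phi>, of k] by simp
qed

lemma start_X_eq: "start_X s p \<omega> = \<xi> (s + int p) \<omega> * start_vol s p \<omega>"
  by (simp add: start_X_def start_vol_def arch_from_eq)

lemma start_vol_eq: "start_vol s p \<omega> = a + (\<Sum>i<p. b (p - i) * start_X s i \<omega>)"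
  by (simp add: start_X_def start_vol_def vol_from_def)

lemma start_X_measurable [measurable]: "start_X s p \<in> borel_measurable M"
  unfolding start_X_def[abs_def] by (rule arch_from_measurable[where X = \<xi>]) (rule noise_measurable)

lemma start_vol_measurable [measurable]: "start_vol s p \<in> borel_measurable M"
  unfolding start_vol_eq[abs_def]
  by (intro borel_measurable_add borel_measurable_const borel_measurable_sum borel_measurable_times
      start_X_measurable)

lemma square_integrable_noise_mult:
  assumes \<phi>: "\<phi> \<in> borel_measurable borel" "integrable M (\<lambda>\<omega>. (\<phi> (\<xi> 0 \<omega>))\<^sup>2)"
    and vol: "square_integrable M (start_vol s p)"
  shows "square_integrable M (\<lambda>\<omega>. \<phi> (\<xi> (s + int p) \<omega>) * start_vol s p \<omega>)"
  unfolding square_integrable_def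
proof
  note [measurable] = \<phi>(1)
  show "(\<lambda>\<omega>. \<phi> (\<xi> (s + int p) \<omega>) * start_vol s p \<omega>) \<in> borel_measurable M" by measurable
  have "integrable M (\<lambda>\<omega>. (\<phi> (\<xi> (s + int p) \<omega>))\<^sup>2 * (start_vol s p \<omega> * start_vol s p \<omega>))"
    unfolding start_vol_def
  proof (rule noise_past(1)[where \<phi> = "\<lambda>t. (\<phi> t)\<^sup>2"])
    show "depends_on_past (s + int p) (\<lambda>x. vol_from a b x s p * vol_from a b x s p)"
      by (intro depends_on_past_mult depends_on_past_vol_from order_refl)
    show "integrable M (\<lambda>\<omega>. vol_from a b (noise_path \<omega>) s p * vol_from a b (noise_path \<omega>) s p)"
      using square_integrable_mult[OF vol vol] by (simp only: start_vol_def)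
  qed (use \<phi> in measurable)
  then show "integrable M (\<lambda>\<omega>. (\<phi> (\<xi> (s + int p) \<omega>) * start_vol s p \<omega>)\<^sup>2)"
    by (simp only: power_mult_distrib power2_eq_square[of "start_vol s p _"])
qed

lemma square_integrable_start_X: "square_integrable M (start_X s p)"
proof (induction p rule: less_induct)
  case (less p)
  have "square_integrable M (start_vol s p)" unfolding start_vol_eq[abs_def]
    by (intro square_integrable_add square_integrable_const square_integrable_sum
        square_integrable_cmult less) auto
  from square_integrable_noise_mult[where \<phi> = "\<lambda>t. t", OF _ noise_square this]
  have "square_integrable M (\<lambda>\<omega>. \<xi> (s + int p) \<omega> * start_vol s p \<omega>)" by simp
  then show ?case by (simp only: start_X_eq[symmetric])
qed

lemma square_integrable_start_vol: "square_integrable M (start_vol s p)"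
  unfolding start_vol_eq[abs_def]
  by (intro square_integrable_add square_integrable_const square_integrable_sum
        square_integrable_cmult square_integrable_start_X)

lemma noise_integrable: "integrable M (\<xi> 0)"
  by (rule square_integrable_imp_integrable[OF noise_measurable noise_square])

lemma noise_centred_square: "integrable M (\<lambda>\<omega>. (\<xi> 0 \<omega> - l)\<^sup>2)"
  unfolding power2_diff using noise_square noise_integrable
  by (intro Bochner_Integration.integrable_add Bochner_Integration.integrable_diff
      integrable_mult_left integrable_mult_right) auto

lemma noise_centred_integrable: "integrable M (\<lambda>\<omega>. \<xi> 0 \<omega> - l)"
  using noise_integrable by (intro Bochner_Integration.integrable_diff) auto

lemma noise_centred_mean: "expectation (\<lambda>\<omega>. \<xi> 0 \<omega> - l) = 0"
  by (subst Bochner_Integration.integral_diff[OF noise_integrable])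
    (auto simp: arch_lambda1_def prob_space)

lemma square_integrable_\<nu>: "square_integrable M (\<nu> s p)"
  unfolding \<nu>_def[abs_def]
  using square_integrable_noise_mult[where \<phi> = "\<lambda>t. t - l", OF _ noise_centred_square square_integrable_start_vol]
  by simp

lemma \<nu>_mean: "expectation (\<nu> s p) = 0"
proof -
  have "expectation (\<lambda>\<omega>. (\<xi> (s + int p) \<omega> - l) * vol_from a b (noise_path \<omega>) s p) =
      expectation (\<lambda>\<omega>. \<xi> 0 \<omega> - l) * expectation (\<lambda>\<omega>. vol_from a b (noise_path \<omega>) s p)"
  proof (rule noise_past(2)[where \<phi> = "\<lambda>t. t - l"])
    show "integrable M (\<lambda>\<omega>. vol_from a b (noise_path \<omega>) s p)"
      using square_integrable_integrable[OF square_integrable_start_vol, of s p] by (simp only: start_vol_def[abs_def])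
  qed (auto intro: depends_on_past_vol_from noise_centred_integrable)
  then show ?thesis by (simp only: \<nu>_def[abs_def] start_vol_def[abs_def] noise_centred_mean mult_zero_left)
qed

lemma \<nu>_square: "expectation (\<lambda>\<omega>. \<nu> s p \<omega> * \<nu> s p \<omega>) = noise_var * expectation (\<lambda>\<omega>. (start_vol s p \<omega>)\<^sup>2)"
proof -
  have "expectation (\<lambda>\<omega>. (\<xi> (s + int p) \<omega> - l)\<^sup>2 * (vol_from a b (noise_path \<omega>) s p * vol_from a b (noise_path \<omega>) s p)) =
      expectation (\<lambda>\<omega>. (\<xi> 0 \<omega> - l)\<^sup>2) *
      expectation (\<lambda>\<omega>. vol_from a b (noise_path \<omega>) s p * vol_from a b (noise_path \<omega>) s p)"
  proof (rule noise_past(2)[where \<phi> = "\<lambda>t. (t - l)\<^sup>2"])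
    show "depends_on_past (s + int p) (\<lambda>x. vol_from a b x s p * vol_from a b x s p)"
      by (intro depends_on_past_mult depends_on_past_vol_from order_refl)
    show "integrable M (\<lambda>\<omega>. vol_from a b (noise_path \<omega>) s p * vol_from a b (noise_path \<omega>) s p)"
      using square_integrable_mult[OF square_integrable_start_vol square_integrable_start_vol, of s p s p]
      by (simp only: start_vol_def)
  qed (auto intro: noise_centred_square)
  moreover have "(\<lambda>\<omega>. \<nu> s p \<omega> * \<nu> s p \<omega>) =
      (\<lambda>\<omega>. (\<xi> (s + int p) \<omega> - l)\<^sup>2 * (vol_from a b (noise_path \<omega>) s p * vol_from a b (noise_path \<omega>) s p))"
    by (simp add: \<nu>_def start_vol_def power2_eq_square mult_ac)
  ultimately show ?thesis by (simp only: arch_lambda1_def start_vol_def power2_eq_square[of "vol_from _ _ _ _ _"])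
qed

lemma \<nu>_orthogonal_less:
  assumes "i < j"
  shows "expectation (\<lambda>\<omega>. \<nu> s i \<omega> * \<nu> s j \<omega>) = 0"
proof -
  \<comment> \<open>The earlier innovation times the later volatility is known before time \<open>s + j\<close>.\<close>
  let ?G = "\<lambda>x. ((x (s + int i) + (- l)) * vol_from a b x s i) * vol_from a b x s j"
  have eq: "?G (noise_path \<omega>) = \<nu> s i \<omega> * start_vol s j \<omega>" for \<omega>
    by (simp add: \<nu>_def start_vol_def)
  have "expectation (\<lambda>\<omega>. (\<xi> (s + int j) \<omega> - l) * ?G (noise_path \<omega>)) =
      expectation (\<lambda>\<omega>. \<xi> 0 \<omega> - l) * expectation (\<lambda>\<omega>. ?G (noise_path \<omega>))"
  proof (rule noise_past(2)[where \<phi> = "\<lambda>t. t - l"])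
    show "depends_on_past (s + int j) ?G"
      using assms
      by (intro depends_on_past_mult depends_on_past_vol_from depends_on_past_add
          depends_on_past_const depends_on_past_coordinate) auto
    show "integrable M (\<lambda>\<omega>. ?G (noise_path \<omega>))"
      unfolding eq by (rule square_integrable_mult[OF square_integrable_\<nu> square_integrable_start_vol])
  qed (auto intro: noise_centred_integrable)
  moreover have "(\<lambda>\<omega>. \<nu> s i \<omega> * \<nu> s j \<omega>) = (\<lambda>\<omega>. (\<xi> (s + int j) \<omega> - l) * ?G (noise_path \<omega>))"
    unfolding eq by (simp add: \<nu>_def mult_ac)
  ultimately show ?thesis by (simp only: noise_centred_mean mult_zero_left)
qed

lemma \<nu>_orthogonal: "i \<noteq> j \<Longrightarrow> expectation (\<lambda>\<omega>. \<nu> s i \<omega> * \<nu> s j \<omega>) = 0"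
  using \<nu>_orthogonal_less[of i j s] \<nu>_orthogonal_less[of j i s]
  by (cases i j rule: linorder_cases) (auto simp: mult.commute)

text \<open>
  Only the diagonal terms of the product survive. All second moments below are instances.
\<close>

lemma expectation_product_of_innovation_sums:
  assumes "finite I" "finite J"
  shows "expectation (\<lambda>\<omega>. (c + (\<Sum>i\<in>I. f i * \<nu> s i \<omega>)) * (d + (\<Sum>j\<in>J. g j * \<nu> s j \<omega>))) =
    c * d + noise_var * (\<Sum>i\<in>I \<inter> J. f i * g i * expectation (\<lambda>\<omega>. (start_vol s i \<omega>)\<^sup>2))"
proof -
  note [simp] = square_integrable_integrable[OF square_integrable_\<nu>]
    square_integrable_mult[OF square_integrable_\<nu> square_integrable_\<nu>] \<nu>_mean
  have eq: "(\<lambda>\<omega>. (c + (\<Sum>i\<in>I. f i * \<nu> s i \<omega>)) * (d + (\<Sum>j\<in>J. g j * \<nu> s j \<omega>))) =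
      (\<lambda>\<omega>. c * d + (\<Sum>j\<in>J. c * (g j * \<nu> s j \<omega>)) + (\<Sum>i\<in>I. d * (f i * \<nu> s i \<omega>)) +
        (\<Sum>i\<in>I. \<Sum>j\<in>J. f i * g j * (\<nu> s i \<omega> * \<nu> s j \<omega>)))" (is "?lhs = ?rhs")
  proof
    fix \<omega>
    have dist: "(c + A) * (d + B) = c * d + c * B + d * A + A * B" for A B
      by (simp add: algebra_simps)
    have "(\<Sum>i\<in>I. f i * \<nu> s i \<omega>) * (\<Sum>j\<in>J. g j * \<nu> s j \<omega>) =
        (\<Sum>i\<in>I. \<Sum>j\<in>J. f i * g j * (\<nu> s i \<omega> * \<nu> s j \<omega>))"
      by (simp add: sum_product mult_ac)
    then show "?lhs \<omega> = ?rhs \<omega>"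
      by (simp only: dist sum_distrib_left)
  qed
  have "expectation (\<lambda>\<omega>. (c + (\<Sum>i\<in>I. f i * \<nu> s i \<omega>)) * (d + (\<Sum>j\<in>J. g j * \<nu> s j \<omega>))) =
      c * d + (\<Sum>i\<in>I. \<Sum>j\<in>J. f i * g j * expectation (\<lambda>\<omega>. \<nu> s i \<omega> * \<nu> s j \<omega>))"
    unfolding eq by (simp add: prob_space)
  also have "(\<Sum>i\<in>I. \<Sum>j\<in>J. f i * g j * expectation (\<lambda>\<omega>. \<nu> s i \<omega> * \<nu> s j \<omega>)) =
      (\<Sum>i\<in>I. \<Sum>j\<in>J. if j = i then f i * g i * (noise_var * expectation (\<lambda>\<omega>. (start_vol s i \<omega>)\<^sup>2)) else 0)"
    by (intro sum.cong refl) (simp add: \<nu>_orthogonal \<nu>_square)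
  also have "\<dots> = (\<Sum>i\<in>I. if i \<in> J then f i * g i * (noise_var * expectation (\<lambda>\<omega>. (start_vol s i \<omega>)\<^sup>2)) else 0)"
    using assms by (simp add: sum.delta)
  also have "\<dots> = (\<Sum>i\<in>I \<inter> J. f i * g i * (noise_var * expectation (\<lambda>\<omega>. (start_vol s i \<omega>)\<^sup>2)))"
    using assms by (simp add: sum.inter_restrict)
  also have "\<dots> = noise_var * (\<Sum>i\<in>I \<inter> J. f i * g i * expectation (\<lambda>\<omega>. (start_vol s i \<omega>)\<^sup>2))"
    by (simp add: sum_distrib_left mult_ac)
  finally show ?thesis .
qed

definition start_mean :: "nat \<Rightarrow> real" where
  "start_mean p = l * a * (\<Sum>i\<le>p. z i)"

text \<open>
  The started process satisfies \<open>X = (\<nu> + \<lambda>\<^sub>1 a) + u * X\<close>, a renewal equation with resolvent \<open>z\<close>.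
\<close>

lemma start_X_innovations: "start_X s p \<omega> = start_mean p + (\<Sum>i\<le>p. z (p - i) * \<nu> s i \<omega>)"
proof -
  have "start_X s n \<omega> = (\<nu> s n \<omega> + l * a) + (\<Sum>i\<le>n. u i * start_X s (n - i) \<omega>)" for n
  proof -
    have "(\<Sum>i\<le>n. u i * start_X s (n - i) \<omega>) = (\<Sum>i\<in>{1..n}. u i * start_X s (n - i) \<omega>)"
      by (rule sum.mono_neutral_right) auto
    also have "\<dots> = (\<Sum>j<n. l * b (n - j) * start_X s j \<omega>)"
      by (rule sum.reindex_bij_witness[where i="\<lambda>j. n - j" and j="\<lambda>j. n - j"]) auto
    also have "\<dots> = l * start_vol s n \<omega> - l * a"
      by (simp add: start_vol_eq sum_distrib_left algebra_simps)
    finally show ?thesis by (simp add: start_X_eq \<nu>_def algebra_simps)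
  qed
  then have "start_X s p \<omega> = (\<Sum>i\<le>p. z i * (\<nu> s (p - i) \<omega> + l * a))"
    by (rule renewal_resolvent[OF renewal_z])
  also have "\<dots> = start_mean p + (\<Sum>i\<le>p. z i * \<nu> s (p - i) \<omega>)"
    by (simp add: start_mean_def algebra_simps sum.distrib sum_distrib_left)
  also have "(\<Sum>i\<le>p. z i * \<nu> s (p - i) \<omega>) = (\<Sum>i\<le>p. z (p - i) * \<nu> s i \<omega>)"
    by (rule sum.reindex_bij_witness[where i="\<lambda>j. p - j" and j="\<lambda>j. p - j"]) auto
  finally show ?thesis .
qed

text \<open>
  The summand of \<open>start_X_innovations\<close> with the present innovation drops out, as \<open>z 0 = 1\<close>.
\<close>

lemma start_vol_innovations: "l * start_vol s p \<omega> = start_mean p + (\<Sum>i<p. z (p - i) * \<nu> s i \<omega>)"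
proof -
  have "l * start_vol s p \<omega> = start_X s p \<omega> - \<nu> s p \<omega>" by (simp add: start_X_eq \<nu>_def algebra_simps)
  also have "\<dots> = start_mean p + (\<Sum>i<p. z (p - i) * \<nu> s i \<omega>)"
    using renewal_0[OF renewal_z] by (simp add: start_X_innovations lessThan_Suc_atMost[symmetric])
  finally show ?thesis .
qed

definition vol_moment :: "nat \<Rightarrow> real" where
  "vol_moment p = expectation (\<lambda>\<omega>. (start_vol 0 p \<omega>)\<^sup>2)"

lemma start_vol_square_rec:
  "l\<^sup>2 * expectation (\<lambda>\<omega>. (start_vol s p \<omega>)\<^sup>2) =
     (start_mean p)\<^sup>2 + noise_var * (\<Sum>i<p. (z (p - i))\<^sup>2 * expectation (\<lambda>\<omega>. (start_vol s i \<omega>)\<^sup>2))"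
proof -
  have "l\<^sup>2 * expectation (\<lambda>\<omega>. (start_vol s p \<omega>)\<^sup>2) = expectation (\<lambda>\<omega>. (l * start_vol s p \<omega>) * (l * start_vol s p \<omega>))"
    by (simp add: power2_eq_square mult_ac)
  also have "\<dots> = (start_mean p)\<^sup>2 + noise_var * (\<Sum>i<p. (z (p - i))\<^sup>2 * expectation (\<lambda>\<omega>. (start_vol s i \<omega>)\<^sup>2))"
    unfolding start_vol_innovations
    by (subst expectation_product_of_innovation_sums) (auto simp: power2_eq_square)
  finally show ?thesis .
qed

text \<open>
  The recursion determines the second moments of the volatility and does not mention \<open>s\<close>. This is
  where the stationarity of the limit comes from.
\<close>

lemma start_vol_square_eq_vol_moment: "expectation (\<lambda>\<omega>. (start_vol s p \<omega>)\<^sup>2) = vol_moment p"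
proof (induction p rule: less_induct)
  case (less p)
  have "(\<Sum>i<p. (z (p - i))\<^sup>2 * expectation (\<lambda>\<omega>. (start_vol s i \<omega>)\<^sup>2)) =
      (\<Sum>i<p. (z (p - i))\<^sup>2 * expectation (\<lambda>\<omega>. (start_vol 0 i \<omega>)\<^sup>2))"
    using less by (intro sum.cong) (auto simp: vol_moment_def)
  then have "l\<^sup>2 * expectation (\<lambda>\<omega>. (start_vol s p \<omega>)\<^sup>2) = l\<^sup>2 * vol_moment p"
    unfolding vol_moment_def by (simp only: start_vol_square_rec)
  then show ?case using mean_pos by simp
qed

lemma start_X_mean: "expectation (start_X s p) = start_mean p"
proof -
  have "expectation (\<lambda>\<omega>. (start_mean p + (\<Sum>i\<in>{..p}. z (p - i) * \<nu> s i \<omega>)) * (1 + (\<Sum>j\<in>{}. (0::real) * \<nu> s j \<omega>))) =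
     start_mean p * 1 + noise_var * (\<Sum>i\<in>{..p} \<inter> {}. z (p - i) * 0 * expectation (\<lambda>\<omega>. (start_vol s i \<omega>)\<^sup>2))"
    by (rule expectation_product_of_innovation_sums) auto
  then show ?thesis by (simp add: start_X_innovations[abs_def])
qed

definition start_cov :: "nat \<Rightarrow> nat \<Rightarrow> real" where
  "start_cov k p = noise_var * (\<Sum>i\<le>p. z (p - i) * z (p - i + k) * vol_moment i)"

lemma start_X_product_mean: "expectation (\<lambda>\<omega>. start_X s p \<omega> * start_X s (p + k) \<omega>) = start_mean p * start_mean (p + k) + start_cov k p"
proof -
  have "{..p} \<inter> {..p + k} = {..p}" by auto
  moreover have "z (p + k - i) = z (p - i + k)" if "i \<le> p" for i using that by simp
  ultimately show ?thesis
    unfolding start_X_innovations start_cov_def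
    by (subst expectation_product_of_innovation_sums) (auto simp: start_vol_square_eq_vol_moment intro!: sum.cong)
qed

lemma noise_var_nonneg: "0 \<le> noise_var" by (rule variance_positive)

text \<open>
  The mean of the volatility is at least \<open>a\<close>.
\<close>

lemma vol_moment_lower: "a\<^sup>2 \<le> vol_moment p"
proof -
  have nn: "0 \<le> vol_moment i" for i by (simp add: vol_moment_def)
  have "z 0 \<le> (\<Sum>i\<le>p. z i)" using z_nonneg by (intro member_le_sum) auto
  then have "l * a \<le> start_mean p" using mean_pos a_pos by (simp add: start_mean_def)
  then have "(l * a)\<^sup>2 \<le> (start_mean p)\<^sup>2" using mean_pos a_pos by (intro power_mono) auto
  also have "\<dots> \<le> (start_mean p)\<^sup>2 + noise_var * (\<Sum>i<p. (z (p - i))\<^sup>2 * vol_moment i)"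
    using noise_var_nonneg nn by (simp add: sum_nonneg)
  also have "\<dots> = l\<^sup>2 * vol_moment p" using start_vol_square_rec[of 0 p] by (simp add: start_vol_square_eq_vol_moment)
  finally show ?thesis using mean_pos by (simp add: power_mult_distrib)
qed

lemma start_mean_le: "start_mean p \<le> l * a * suminf z"
  unfolding start_mean_def using z_summable z_nonneg mean_pos a_pos
  by (intro mult_left_mono sum_le_suminf) auto

lemma start_mean_nonneg: "0 \<le> start_mean p"
  unfolding start_mean_def using mean_pos a_pos z_nonneg by (intro mult_nonneg_nonneg sum_nonneg) auto

lemma start_mean_lim: "start_mean \<longlonglongrightarrow> l * a * suminf z"
  unfolding start_mean_def[abs_def] using summable_LIMSEQ'[OF z_summable] by (intro tendsto_intros)

lemma Omega_square: "(arch_Omega M b \<xi>)\<^sup>2 = noise_var / l\<^sup>2 * (\<Sum>j. (z (Suc j))\<^sup>2)"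
  using noise_var_nonneg suminf_nonneg[OF z2_summable]
  by (simp add: arch_Omega_def arch_sigma_def power_mult_distrib power_divide)

lemma Omega_square_lt: "(arch_Omega M b \<xi>)\<^sup>2 < 1"
proof -
  have "0 \<le> arch_Omega M b \<xi>"
    using mean_pos noise_var_nonneg suminf_nonneg[OF z2_summable] by (simp add: arch_Omega_def arch_sigma_def)
  then show ?thesis using Omega_lt_1 by (simp add: power_less_one_iff)
qed

text \<open>
  The fixed point of the upper estimate \<open>w \<mapsto> (a * suminf z)\<^sup>2 + \<Omega>\<^sup>2 w\<close> for the recursion of
  \<open>start_vol_square_rec\<close>.
\<close>

definition vol_bound :: real where
  "vol_bound = (a * suminf z)\<^sup>2 / (1 - (arch_Omega M b \<xi>)\<^sup>2)"

lemma vol_moment_upper: "vol_moment p \<le> vol_bound"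
proof (induction p rule: less_induct)
  case (less p)
  have bound_nonneg: "0 \<le> vol_bound" using Omega_square_lt by (simp add: vol_bound_def)
  have "(\<Sum>i<p. (z (p - i))\<^sup>2 * vol_moment i) \<le> (\<Sum>i<p. (z (p - i))\<^sup>2 * vol_bound)"
    using less by (intro sum_mono mult_left_mono) auto
  also have "\<dots> = (\<Sum>j<p. (z (Suc j))\<^sup>2) * vol_bound"
    unfolding sum_distrib_right
    by (rule sum.reindex_bij_witness[where i="\<lambda>j. p - Suc j" and j="\<lambda>j. p - Suc j"])
      (auto simp: Suc_diff_Suc)
  also have "\<dots> \<le> (\<Sum>j. (z (Suc j))\<^sup>2) * vol_bound"
    using bound_nonneg z2_summable by (intro mult_right_mono sum_le_suminf) auto
  finally have sum: "(\<Sum>i<p. (z (p - i))\<^sup>2 * vol_moment i) \<le> (\<Sum>j. (z (Suc j))\<^sup>2) * vol_bound" .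
  have "l\<^sup>2 * vol_moment p = (start_mean p)\<^sup>2 + noise_var * (\<Sum>i<p. (z (p - i))\<^sup>2 * vol_moment i)"
    using start_vol_square_rec[of 0 p] by (simp add: start_vol_square_eq_vol_moment)
  also have "\<dots> \<le> (l * a * suminf z)\<^sup>2 + noise_var * ((\<Sum>j. (z (Suc j))\<^sup>2) * vol_bound)"
    using start_mean_le start_mean_nonneg sum noise_var_nonneg by (intro add_mono power_mono mult_left_mono) auto
  also have "\<dots> = l\<^sup>2 * ((a * suminf z)\<^sup>2 + (arch_Omega M b \<xi>)\<^sup>2 * vol_bound)"
  proof -
    have "noise_var * (\<Sum>j. (z (Suc j))\<^sup>2) = l\<^sup>2 * (arch_Omega M b \<xi>)\<^sup>2"
      unfolding Omega_square using mean_pos by simp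
    then show ?thesis
      by (simp only: distrib_left power_mult_distrib mult.assoc[symmetric])
  qed
  also have "(a * suminf z)\<^sup>2 + (arch_Omega M b \<xi>)\<^sup>2 * vol_bound = vol_bound"
    using Omega_square_lt by (simp add: vol_bound_def field_simps)
  finally show ?case using mean_pos by simp
qed

lemma start_cov_lower: "noise_var * a\<^sup>2 * (\<Sum>j\<le>p. z j * z (j + k)) \<le> start_cov k p"
proof -
  have "a\<^sup>2 * (\<Sum>j\<le>p. z j * z (j + k)) = (\<Sum>i\<le>p. z (p - i) * z (p - i + k) * a\<^sup>2)"
    unfolding sum_distrib_left
    by (rule sum.reindex_bij_witness[where i="\<lambda>j. p - j" and j="\<lambda>j. p - j"]) auto
  also have "\<dots> \<le> (\<Sum>i\<le>p. z (p - i) * z (p - i + k) * vol_moment i)"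
    using vol_moment_lower z_nonneg by (intro sum_mono mult_left_mono) auto
  finally show ?thesis unfolding start_cov_def mult.assoc using noise_var_nonneg by (intro mult_left_mono) auto
qed

lemma start_cov_upper: "start_cov k p \<le> noise_var * vol_bound * (\<Sum>j. z j * z (j + k))"
proof -
  have bound_nonneg: "0 \<le> vol_bound" using Omega_square_lt by (simp add: vol_bound_def)
  have "(\<Sum>i\<le>p. z (p - i) * z (p - i + k) * vol_moment i) \<le> (\<Sum>i\<le>p. z (p - i) * z (p - i + k) * vol_bound)"
    using vol_moment_upper z_nonneg by (intro sum_mono mult_left_mono) auto
  also have "\<dots> = vol_bound * (\<Sum>j\<le>p. z j * z (j + k))"
    unfolding sum_distrib_left
    by (rule sum.reindex_bij_witness[where i="\<lambda>j. p - j" and j="\<lambda>j. p - j"]) auto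
  also have "\<dots> \<le> vol_bound * (\<Sum>j. z j * z (j + k))"
    using bound_nonneg z_nonneg z_summable by (intro mult_left_mono sum_le_suminf summable_autocorrelation) auto
  finally show ?thesis unfolding start_cov_def mult.assoc using noise_var_nonneg by (intro mult_left_mono) auto
qed

section \<open>The stationary solution as a monotone limit\<close>

text \<open>
  The started processes converge almost surely; elsewhere \<open>lim\<close> is an arbitrary value.
\<close>

definition limit_X :: "int \<Rightarrow> 'a \<Rightarrow> real" where
  "limit_X k \<omega> = lim (\<lambda>N. start_X (k - int N) N \<omega>)"

lemma limit_X_measurable [measurable]: "limit_X k \<in> borel_measurable M"
  unfolding limit_X_def[abs_def] by (rule borel_measurable_lim_metric) (rule start_X_measurable)

lemma AE_all_noise_nonneg: "AE \<omega> in M. \<forall>k. 0 \<le> \<xi> k \<omega>"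
  by (subst AE_all_countable) (rule allI, rule noise_nonneg)

lemma start_X_nonneg: "\<forall>k. 0 \<le> \<xi> k \<omega> \<Longrightarrow> 0 \<le> start_X s p \<omega>"
  unfolding start_X_def using a_pos b_nonneg by (intro arch_from_nonneg) auto

lemma start_X_mono: "\<forall>k. 0 \<le> \<xi> k \<omega> \<Longrightarrow> mono (\<lambda>N. start_X (k - int N) N \<omega>)"
proof (rule incseq_SucI)
  fix N
  assume "\<forall>k. 0 \<le> \<xi> k \<omega>"
  then have "arch_from a b (noise_path \<omega>) (k - int N) N \<le> arch_from a b (noise_path \<omega>) (k - int N - 1) (Suc N)"
    using a_pos b_nonneg by (intro arch_from_earlier_start) auto
  moreover have "k - int N - 1 = k - int (Suc N)" by simp
  ultimately show "start_X (k - int N) N \<omega> \<le> start_X (k - int (Suc N)) (Suc N) \<omega>"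
    unfolding start_X_def by (simp only:)
qed

lemma AE_start_X_tendsto_limit_X: "AE \<omega> in M. \<forall>k. (\<lambda>N. start_X (k - int N) N \<omega>) \<longlonglongrightarrow> limit_X k \<omega>"
proof (subst AE_all_countable, rule allI)
  fix k
  have "AE \<omega> in M. convergent (\<lambda>N. start_X (k - int N) N \<omega>)"
  proof (rule AE_convergent_of_bounded_integrals[where C = "l * a * suminf z"])
    show "integrable M (start_X (k - int N) N)" for N
      by (rule square_integrable_integrable[OF square_integrable_start_X])
    show "AE \<omega> in M. mono (\<lambda>N. start_X (k - int N) N \<omega>)"
      using AE_all_noise_nonneg by (rule AE_mp) (auto intro!: AE_I2 start_X_mono)
    show "AE \<omega> in M. 0 \<le> start_X (k - int N) N \<omega>" for N
      using AE_all_noise_nonneg by (rule AE_mp) (auto intro!: AE_I2 start_X_nonneg)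
    show "expectation (start_X (k - int N) N) \<le> l * a * suminf z" for N
      by (simp only: start_X_mean start_mean_le)
  qed
  then show "AE \<omega> in M. (\<lambda>N. start_X (k - int N) N \<omega>) \<longlonglongrightarrow> limit_X k \<omega>"
    by (rule AE_mp) (auto intro!: AE_I2 simp: limit_X_def convergent_LIMSEQ_iff)
qed

lemma limit_X_mean: "integrable M (limit_X k)" "expectation (limit_X k) = l * a * suminf z"
proof -
  have i: "integrable M (start_X (k - int N) N)" for N
    by (rule square_integrable_integrable[OF square_integrable_start_X])
  have mo: "AE \<omega> in M. mono (\<lambda>N. start_X (k - int N) N \<omega>)"
    using AE_all_noise_nonneg by (rule AE_mp) (auto intro!: AE_I2 start_X_mono)
  have nn: "AE \<omega> in M. 0 \<le> start_X (k - int N) N \<omega>" for N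
    using AE_all_noise_nonneg by (rule AE_mp) (auto intro!: AE_I2 start_X_nonneg)
  have lim: "AE \<omega> in M. (\<lambda>N. start_X (k - int N) N \<omega>) \<longlonglongrightarrow> limit_X k \<omega>"
    using AE_start_X_tendsto_limit_X by (rule AE_mp) (auto intro!: AE_I2)
  have ilim: "(\<lambda>N. expectation (start_X (k - int N) N)) \<longlonglongrightarrow> l * a * suminf z"
    by (simp only: start_X_mean start_mean_lim)
  show "integrable M (limit_X k)" "expectation (limit_X k) = l * a * suminf z"
    by (rule integral_monotone_convergence_nonneg[OF i mo nn lim ilim limit_X_measurable])+
qed

lemma AE_limit_X_nonneg: "AE \<omega> in M. \<forall>k. 0 \<le> limit_X k \<omega>"
  using AE_start_X_tendsto_limit_X AE_all_noise_nonneg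
  by eventually_elim (auto intro!: LIMSEQ_le_const start_X_nonneg)

text \<open>
  Both factors are approximated by processes with the same starting time \<open>k - N\<close>, so that
  \<open>start_X_product_mean\<close> applies; its value is the same for all \<open>k\<close>.
\<close>

lemma limit_X_product:
  fixes k :: int and j :: nat
  defines "c \<equiv> lim (\<lambda>N. start_mean N * start_mean (N + j) + start_cov j N)"
  shows "integrable M (\<lambda>\<omega>. limit_X k \<omega> * limit_X (k + int j) \<omega>)"
    and "expectation (\<lambda>\<omega>. limit_X k \<omega> * limit_X (k + int j) \<omega>) = c"
    and "(\<lambda>N. start_mean N * start_mean (N + j) + start_cov j N) \<longlonglongrightarrow> c"
proof -
  let ?f = "\<lambda>N \<omega>. start_X (k - int N) N \<omega> * start_X (k - int N) (N + j) \<omega>"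
  have shift: "start_X (k - int N) (N + j) \<omega> = start_X (k + int j - int (N + j)) (N + j) \<omega>" for N \<omega>
    by simp
  have i: "integrable M (?f N)" for N
    by (rule square_integrable_mult[OF square_integrable_start_X square_integrable_start_X])
  have mo: "AE \<omega> in M. mono (\<lambda>N. ?f N \<omega>)"
    using AE_all_noise_nonneg
  proof eventually_elim
    case (elim \<omega>)
    show ?case
    proof (rule monoI)
      fix N N' :: nat assume "N \<le> N'"
      then have "start_X (k - int N) N \<omega> \<le> start_X (k - int N') N' \<omega>"
        "start_X (k + int j - int (N + j)) (N + j) \<omega> \<le> start_X (k + int j - int (N' + j)) (N' + j) \<omega>"
        using monoD[OF start_X_mono[OF elim, of k], of N N']
          monoD[OF start_X_mono[OF elim, of "k + int j"], of "N + j" "N' + j"] by simp_all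
      then show "?f N \<omega> \<le> ?f N' \<omega>"
        unfolding shift by (intro mult_mono) (auto intro: start_X_nonneg[OF elim])
    qed
  qed
  have nn: "AE \<omega> in M. 0 \<le> ?f N \<omega>" for N
    using AE_all_noise_nonneg by eventually_elim (auto intro!: mult_nonneg_nonneg start_X_nonneg)
  have lim: "AE \<omega> in M. (\<lambda>N. ?f N \<omega>) \<longlonglongrightarrow> limit_X k \<omega> * limit_X (k + int j) \<omega>"
    using AE_start_X_tendsto_limit_X
  proof eventually_elim
    case (elim \<omega>)
    have "(\<lambda>N. start_X (k + int j - int (N + j)) (N + j) \<omega>) \<longlonglongrightarrow> limit_X (k + int j) \<omega>"
      using LIMSEQ_ignore_initial_segment[OF elim[rule_format, of "k + int j"], of j] .
    then show ?case unfolding shift using elim by (intro tendsto_mult) auto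
  qed
  have ev: "expectation (?f N) = start_mean N * start_mean (N + j) + start_cov j N" for N
    by (rule start_X_product_mean)
  have bound: "start_mean N * start_mean (N + j) + start_cov j N \<le>
      (l * a * suminf z) * (l * a * suminf z) + noise_var * vol_bound * (\<Sum>i. z i * z (i + j))" for N
    using mean_pos a_pos suminf_nonneg[OF z_summable z_nonneg]
    by (intro add_mono mult_mono start_cov_upper start_mean_le start_mean_nonneg) auto
  have inc: "incseq (\<lambda>N. start_mean N * start_mean (N + j) + start_cov j N)"
  proof (rule monoI)
    fix N N' :: nat assume "N \<le> N'"
    have "AE \<omega> in M. ?f N \<omega> \<le> ?f N' \<omega>"
      using mo
    proof eventually_elim
      case (elim \<omega>)
      from monoD[OF this \<open>N \<le> N'\<close>] show ?case .
    qed
    then have "expectation (?f N) \<le> expectation (?f N')" by (rule integral_mono_AE[OF i i])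
    then show "start_mean N * start_mean (N + j) + start_cov j N \<le> start_mean N' * start_mean (N' + j) + start_cov j N'" by (simp only: ev)
  qed
  obtain L where L: "(\<lambda>N. start_mean N * start_mean (N + j) + start_cov j N) \<longlonglongrightarrow> L"
    by (rule incseq_convergent[OF inc allI[OF bound]])
  show c: "(\<lambda>N. start_mean N * start_mean (N + j) + start_cov j N) \<longlonglongrightarrow> c"
    unfolding c_def limI[OF L] by (rule L)
  then have ilim: "(\<lambda>N. expectation (?f N)) \<longlonglongrightarrow> c" by (simp only: ev)
  have meas: "(\<lambda>\<omega>. limit_X k \<omega> * limit_X (k + int j) \<omega>) \<in> borel_measurable M" by simp
  show "integrable M (\<lambda>\<omega>. limit_X k \<omega> * limit_X (k + int j) \<omega>)"
    "expectation (\<lambda>\<omega>. limit_X k \<omega> * limit_X (k + int j) \<omega>) = c"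
    by (rule integral_monotone_convergence_nonneg[OF i mo nn lim ilim meas])+
qed

lemma square_integrable_limit_X: "square_integrable M (limit_X k)"
  using limit_X_product(1)[of k 0] by (simp add: square_integrable_def power2_eq_square)

definition limit_cov :: "nat \<Rightarrow> real" where
  "limit_cov j = lim (\<lambda>N. start_cov j N)"

lemma
  shows limit_cov_eq: "cov M (limit_X k) (limit_X (k + int j)) = limit_cov j"
    and start_cov_tendsto_limit_cov: "(\<lambda>N. start_cov j N) \<longlonglongrightarrow> limit_cov j"
proof -
  let ?c = "lim (\<lambda>N. start_mean N * start_mean (N + j) + start_cov j N)" and ?\<mu> = "l * a * suminf z"
  have c: "cov M (limit_X k) (limit_X (k + int j)) = ?c - ?\<mu> * ?\<mu>"
    by (simp only: cov_eq_expectation[OF square_integrable_limit_X square_integrable_limit_X] limit_X_product(2) limit_X_mean(2))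
  have "(\<lambda>N. (start_mean N * start_mean (N + j) + start_cov j N) - start_mean N * start_mean (N + j)) \<longlonglongrightarrow> ?c - ?\<mu> * ?\<mu>"
    by (intro tendsto_diff limit_X_product(3) tendsto_mult start_mean_lim LIMSEQ_ignore_initial_segment)
  then have lim: "(\<lambda>N. start_cov j N) \<longlonglongrightarrow> ?c - ?\<mu> * ?\<mu>" by simp
  then have "limit_cov j = ?c - ?\<mu> * ?\<mu>" unfolding limit_cov_def by (rule limI)
  with c lim show "cov M (limit_X k) (limit_X (k + int j)) = limit_cov j" "(\<lambda>N. start_cov j N) \<longlonglongrightarrow> limit_cov j" by simp_all
qed

lemma limit_cov_bounds:
  "noise_var * a\<^sup>2 * (\<Sum>j. z j * z (j + k)) \<le> limit_cov k"
  "limit_cov k \<le> noise_var * vol_bound * (\<Sum>j. z j * z (j + k))"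
proof -
  have "(\<lambda>p. noise_var * a\<^sup>2 * (\<Sum>j\<le>p. z j * z (j + k))) \<longlonglongrightarrow>
      noise_var * a\<^sup>2 * (\<Sum>j. z j * z (j + k))"
    by (intro tendsto_intros summable_LIMSEQ' summable_autocorrelation z_nonneg z_summable)
  then show "noise_var * a\<^sup>2 * (\<Sum>j. z j * z (j + k)) \<le> limit_cov k"
    by (rule LIMSEQ_le[OF _ start_cov_tendsto_limit_cov]) (use start_cov_lower in blast)
  show "limit_cov k \<le> noise_var * vol_bound * (\<Sum>j. z j * z (j + k))"
    by (rule LIMSEQ_le_const2[OF start_cov_tendsto_limit_cov]) (use start_cov_upper in blast)
qed

lemma weakly_stationary_limit_X: "weakly_stationary M limit_X"
  unfolding weakly_stationary_def
proof (intro conjI allI)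
  have *: "cov M (limit_X n) (limit_X (n + k)) = limit_cov (nat \<bar>k\<bar>)" for n k
  proof (cases "0 \<le> k")
    case True
    then show ?thesis using limit_cov_eq[of n "nat k"] by simp
  next
    case False
    then show ?thesis using limit_cov_eq[of "n + k" "nat (- k)"] by (simp add: cov_commute[of M "limit_X n"])
  qed
  show "cov M (limit_X n) (limit_X (n + k)) = cov M (limit_X i) (limit_X (i + k))" for n i k
    by (simp only: *)
  show "integrable M (\<lambda>\<omega>. (limit_X k \<omega>)\<^sup>2)" for k
    using square_integrable_limit_X by (simp add: square_integrable_def)
qed (simp_all add: limit_X_mean(2))

text \<open>
  Summability cannot be read off from the finiteness of \<open>X\<close>, because a zero of the noise hides the
  volatility. It follows from the finite expectation of the partial sums instead.
\<close>

lemma AE_summable_limit_X: "AE \<omega> in M. \<forall>k. summable (\<lambda>j. b (Suc j) * limit_X (k - int (Suc j)) \<omega>)"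
proof (subst AE_all_countable, rule allI)
  fix k
  let ?f = "\<lambda>N \<omega>. \<Sum>j<N. b (Suc j) * limit_X (k - int (Suc j)) \<omega>"
  have nn: "AE \<omega> in M. \<forall>j. 0 \<le> b (Suc j) * limit_X (k - int (Suc j)) \<omega>"
    using AE_limit_X_nonneg by eventually_elim (auto intro!: mult_nonneg_nonneg b_nonneg)
  have "AE \<omega> in M. convergent (\<lambda>N. ?f N \<omega>)"
  proof (rule AE_convergent_of_bounded_integrals[where C = "arch_B b * (l * a * suminf z)"])
    show "integrable M (?f N)" for N
      by (intro Bochner_Integration.integrable_sum integrable_mult_right limit_X_mean(1))
    show "AE \<omega> in M. mono (\<lambda>N. ?f N \<omega>)"
      using nn by eventually_elim (auto intro!: monoI sum_mono2)
    show "AE \<omega> in M. 0 \<le> ?f N \<omega>" for N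
      using nn by eventually_elim (auto intro!: sum_nonneg)
    show "expectation (?f N) \<le> arch_B b * (l * a * suminf z)" for N
    proof -
      have "expectation (?f N) = (\<Sum>j<N. b (Suc j)) * (l * a * suminf z)"
        by (subst Bochner_Integration.integral_sum)
          (auto simp: limit_X_mean sum_distrib_right)
      also have "\<dots> \<le> arch_B b * (l * a * suminf z)"
        unfolding arch_B_def using mean_pos a_pos suminf_nonneg[OF z_summable z_nonneg] b_nonneg
        by (intro mult_right_mono sum_le_suminf b_summable) auto
      finally show ?thesis .
    qed
  qed
  then show "AE \<omega> in M. summable (\<lambda>j. b (Suc j) * limit_X (k - int (Suc j)) \<omega>)"
    by (simp add: summable_iff_convergent)
qed

text \<open>
  The equation holds for the started processes, and Tannery's theorem takes the sum over the past to
  the limit, with the limit process itself as the dominating term.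
\<close>

lemma arch_solution_limit_X: "arch_solution M a b \<xi> limit_X"
  unfolding arch_solution_def
proof (intro conjI allI)
  show "AE \<omega> in M. \<forall>k. summable (\<lambda>j. b (Suc j) * limit_X (k - int (Suc j)) \<omega>) \<and>
      limit_X k \<omega> = volatility a b limit_X k \<omega> * \<xi> k \<omega>"
    using AE_all_noise_nonneg AE_start_X_tendsto_limit_X AE_limit_X_nonneg AE_summable_limit_X
  proof eventually_elim
    case (elim \<omega>)
    show ?case
    proof (intro allI conjI)
      fix k
      show summ: "summable (\<lambda>j. b (Suc j) * limit_X (k - int (Suc j)) \<omega>)" using elim by blast
      define t where "t j N = (if j < N then
        b (Suc j) * start_X (k - int (Suc j) - int (N - Suc j)) (N - Suc j) \<omega> else 0)" for j N
      have start_X_t: "start_X (k - int N) N \<omega> = \<xi> k \<omega> * (a + (\<Sum>j. t j N))" for N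
      proof -
        have "(\<Sum>j. t j N) = (\<Sum>j<N. t j N)" by (rule suminf_finite) (auto simp: t_def)
        also have "\<dots> = (\<Sum>i<N. b (N - i) * start_X (k - int N) i \<omega>)"
          by (rule sum.reindex_bij_witness[where i="\<lambda>j. N - Suc j" and j="\<lambda>j. N - Suc j"])
            (auto simp: t_def Suc_diff_Suc of_nat_diff)
        finally have "(\<Sum>j. t j N) = (\<Sum>i<N. b (N - i) * start_X (k - int N) i \<omega>)" .
        moreover have "start_X (k - int N) N \<omega> = \<xi> (k - int N + int N) \<omega> * start_vol (k - int N) N \<omega>"
          by (rule start_X_eq)
        ultimately show ?thesis by (simp only: start_vol_eq diff_add_cancel)
      qed
      have t_lim: "(\<lambda>N. t j N) \<longlonglongrightarrow> b (Suc j) * limit_X (k - int (Suc j)) \<omega>" for j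
      proof (rule LIMSEQ_offset)
        have "(\<lambda>N. b (Suc j) * start_X (k - int (Suc j) - int N) N \<omega>) \<longlonglongrightarrow> b (Suc j) * limit_X (k - int (Suc j)) \<omega>"
          using elim(2) by (intro tendsto_intros) blast
        then show "(\<lambda>N. t j (N + Suc j)) \<longlonglongrightarrow> b (Suc j) * limit_X (k - int (Suc j)) \<omega>"
          by (simp add: t_def)
      qed
      have start_X_le_limit_X: "start_X (i - int N) N \<omega> \<le> limit_X i \<omega>" for i N
        using incseq_le[OF start_X_mono[OF elim(1)]] elim(2) by blast
      have t_le: "norm (t j N) \<le> b (Suc j) * limit_X (k - int (Suc j)) \<omega>" for j N
      proof (cases "j < N")
        case True
        have "t j N \<le> b (Suc j) * limit_X (k - int (Suc j)) \<omega>"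
          using True mult_left_mono[OF start_X_le_limit_X[of "k - int (Suc j)" "N - Suc j"] b_nonneg[of "Suc j"]]
          by (simp add: t_def)
        moreover have "0 \<le> t j N"
          using True b_nonneg start_X_nonneg[OF elim(1)] by (auto simp: t_def)
        ultimately show ?thesis by simp
      next
        case False
        then show ?thesis using elim(3) b_nonneg by (auto simp: t_def)
      qed
      have "(\<lambda>N. \<Sum>j. t j N) \<longlonglongrightarrow> (\<Sum>j. b (Suc j) * limit_X (k - int (Suc j)) \<omega>)"
        using tannerys_theorem[of t "\<lambda>j. b (Suc j) * limit_X (k - int (Suc j)) \<omega>" sequentially,
            OF t_lim always_eventually summ] t_le by auto
      then have "(\<lambda>N. start_X (k - int N) N \<omega>) \<longlonglongrightarrow> \<xi> k \<omega> * volatility a b limit_X k \<omega>"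
        unfolding start_X_t volatility_def by (intro tendsto_intros)
      with elim(2) show "limit_X k \<omega> = volatility a b limit_X k \<omega> * \<xi> k \<omega>"
        using LIMSEQ_unique by (metis mult.commute)
    qed
  qed
qed simp

text \<open>
  By uniqueness the solution coincides with the limit process, whose covariances are known.
\<close>

lemma stationary_solution_autocovariance_bounds:
  assumes X: "the_stationary_solution M a b \<xi> X" and \<rho>: "autocovariance_function M X \<rho>"
  shows "noise_var * a\<^sup>2 * (\<Sum>j. z j * z (j + n)) \<le> \<rho> (int n)"
    and "\<rho> (int n) \<le> noise_var * vol_bound * (\<Sum>j. z j * z (j + n))"
proof -
  have eq: "AE \<omega> in M. \<forall>k. limit_X k \<omega> = X k \<omega>"
    using X weakly_stationary_limit_X arch_solution_limit_X unfolding the_stationary_solution_def by blast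
  have [measurable]: "X k \<in> borel_measurable M" for k
    using X by (simp add: the_stationary_solution_def arch_solution_def)
  have mean: "expectation (X k) = expectation (limit_X k)" for k
    using eq by (intro integral_cong_AE) auto
  have "cov M (X 0) (X (int n)) = cov M (limit_X 0) (limit_X (int n))"
    unfolding cov_def mean using eq by (intro integral_cong_AE) auto
  moreover have "\<rho> (int n) = cov M (X 0) (X (0 + int n))"
    using \<rho> unfolding autocovariance_function_def by blast
  ultimately have "\<rho> (int n) = limit_cov n" using limit_cov_eq[of 0 n] by simp
  then show "noise_var * a\<^sup>2 * (\<Sum>j. z j * z (j + n)) \<le> \<rho> (int n)"
    "\<rho> (int n) \<le> noise_var * vol_bound * (\<Sum>j. z j * z (j + n))"
    using limit_cov_bounds[of n] by (simp_all only:)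
qed

end

theorem theorem11:
  fixes M :: "'a measure"
    and \<xi> X :: "int \<Rightarrow> 'a \<Rightarrow> real"
    and a r :: real
    and b \<gamma> :: "nat \<Rightarrow> real"
    and \<rho> :: "int \<Rightarrow> real"
  assumes "prob_space M"
    and "iid M \<xi>"
    and "\<And>k. AE \<omega> in M. 0 \<le> \<xi> k \<omega>"
    and "integrable M (\<xi> 0)"
    and "integrable M (\<lambda>\<omega>. (\<xi> 0 \<omega>)\<^sup>2)"
    and "arch_lambda1 M \<xi> > 0"
    and "arch_sigma M \<xi> > 0"
    and "a > 0"
    and "\<And>j. j \<ge> 1 \<Longrightarrow> b j \<ge> 0"
    and "\<exists>j\<ge>1. b j \<noteq> 0"
    and "summable (\<lambda>j. b (Suc j))"
    and "arch_lambda1 M \<xi> * arch_B b < 1"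
    and "summable (\<lambda>j. (arch_z (arch_lambda1 M \<xi>) b (Suc j))\<^sup>2)"
    and "arch_Omega M b \<xi> < 1"
    and "the_stationary_solution M a b \<xi> X"
    and "autocovariance_function M X \<rho>"
    and "0 < r" and "r \<le> 1"
    and "\<gamma> \<in> weight_class_down r"
  shows "(summable (\<lambda>j. b (Suc j) / r ^ Suc j) \<and>
          arch_lambda1 M \<xi> * (\<Sum>j. b (Suc j) / r ^ Suc j) < 1 \<and>
          (\<exists>C\<^sub>0::real. C\<^sub>0 > 0 \<and> limsup (\<lambda>n. ereal (b n / \<gamma> n)) = ereal C\<^sub>0))
     \<longleftrightarrow> (\<exists>C\<^sub>2::real. C\<^sub>2 > 0 \<and> limsup (\<lambda>n. ereal (\<rho> (int n) / \<gamma> n)) = ereal C\<^sub>2)"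
proof -
  interpret prob_space M by fact
  interpret arch: arch_noise M \<xi> a b
    by unfold_locales (use assms in blast)+
  let ?l = "arch_lambda1 M \<xi>"
  let ?u = "\<lambda>j. if j = 0 then 0 else ?l * b j"
  have \<gamma>: "\<gamma> n > 0" for n
    using assms(19) by (auto simp: weight_class_down_def weight_class_def)
  have l: "?l > 0" by fact
  have "0 < variance (\<xi> 0)" using assms(7) by (simp add: arch_sigma_def)
  then have lower: "0 < variance (\<xi> 0) * a\<^sup>2" using \<open>a > 0\<close> by simp
  have "0 < a\<^sup>2" using \<open>a > 0\<close> by simp
  also have "a\<^sup>2 \<le> arch.vol_bound" using order_trans[OF arch.vol_moment_lower arch.vol_moment_upper] .
  finally have upper: "0 < variance (\<xi> 0) * arch.vol_bound" using \<open>0 < variance (\<xi> 0)\<close> by simp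
  note main = renewal_autocorrelation_weight_iff[OF arch.renewal_z \<open>\<gamma> \<in> weight_class_down r\<close> \<open>0 < r\<close>
      arch.u_suminf lower upper
      arch.stationary_solution_autocovariance_bounds[OF assms(15,16)]]
  have Suc: "(\<lambda>j. ?u (Suc j) / r ^ Suc j) = (\<lambda>j. ?l * (b (Suc j) / r ^ Suc j))" by simp
  have summ: "summable (\<lambda>n. ?u n / r ^ n) \<longleftrightarrow> summable (\<lambda>j. b (Suc j) / r ^ Suc j)"
    using summable_Suc_iff[of "\<lambda>n. ?u n / r ^ n"] l unfolding Suc by (simp only: summable_cmult_iff) simp
  have sum: "(\<Sum>n. ?u n / r ^ n) = ?l * (\<Sum>j. b (Suc j) / r ^ Suc j)"
    if "summable (\<lambda>j. b (Suc j) / r ^ Suc j)"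
  proof -
    have "(\<Sum>n. ?u n / r ^ n) = (\<Sum>j. ?u (Suc j) / r ^ Suc j)"
      using suminf_split_head[of "\<lambda>n. ?u n / r ^ n"] that summ by simp
    also have "\<dots> = ?l * (\<Sum>j. b (Suc j) / r ^ Suc j)"
      unfolding Suc by (rule suminf_mult[OF that])
    finally show ?thesis .
  qed
  \<comment> \<open>The two sequences are proportional except at the dummy index \<open>0\<close>.\<close>
  have tail: "\<forall>\<^sub>F n in sequentially. ?u n / \<gamma> n = ?l * (b n / \<gamma> n)"
    using eventually_gt_at_top[of 0] by eventually_elim simp
  have "(\<exists>C>0. limsup (\<lambda>n. ereal (?u n / \<gamma> n)) = ereal C) \<longleftrightarrow>
      (\<exists>C>0. limsup (\<lambda>n. ereal (b n / \<gamma> n)) = ereal C)"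
  proof -
    have "\<forall>\<^sub>F n in sequentially. 0 \<le> b n / \<gamma> n"
      using eventually_ge_at_top[of 1]
      by eventually_elim (use assms(9) \<gamma> in \<open>auto simp: less_imp_le\<close>)
    moreover have "\<forall>\<^sub>F n in sequentially. 0 \<le> ?u n / \<gamma> n"
      using tail calculation
    proof eventually_elim
      case (elim n)
      show ?case unfolding elim(1) using l elim(2) by (intro mult_nonneg_nonneg) auto
    qed
    moreover have "(\<exists>K. \<forall>\<^sub>F n in sequentially. ?u n / \<gamma> n \<le> K) \<longleftrightarrow>
        (\<exists>K. \<forall>\<^sub>F n in sequentially. b n / \<gamma> n \<le> K)"
    proof
      assume "\<exists>K. \<forall>\<^sub>F n in sequentially. ?u n / \<gamma> n \<le> K"
      then obtain K where "\<forall>\<^sub>F n in sequentially. ?u n / \<gamma> n \<le> K" ..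
      then have "\<forall>\<^sub>F n in sequentially. b n / \<gamma> n \<le> K / ?l"
        using tail by eventually_elim (use l in \<open>simp add: pos_le_divide_eq mult.commute\<close>)
      then show "\<exists>K. \<forall>\<^sub>F n in sequentially. b n / \<gamma> n \<le> K" ..
    next
      assume "\<exists>K. \<forall>\<^sub>F n in sequentially. b n / \<gamma> n \<le> K"
      then obtain K where "\<forall>\<^sub>F n in sequentially. b n / \<gamma> n \<le> K" ..
      then have "\<forall>\<^sub>F n in sequentially. ?u n / \<gamma> n \<le> ?l * K"
        using tail
      proof eventually_elim
        case (elim n)
        show ?case unfolding elim(2) using l elim(1) by (intro mult_left_mono) auto
      qed
      then show "\<exists>K. \<forall>\<^sub>F n in sequentially. ?u n / \<gamma> n \<le> K" ..
    qed
    moreover have "(\<lambda>n. ?u n / \<gamma> n) \<longlonglongrightarrow> 0 \<longleftrightarrow> (\<lambda>n. b n / \<gamma> n) \<longlonglongrightarrow> 0"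
      using tendsto_cong[OF tail, of 0] tendsto_mult_left_iff[of ?l "\<lambda>n. b n / \<gamma> n" 0] l by simp
    ultimately show ?thesis by (simp only: limsup_positive_finite_iff)
  qed
  then have "(summable (\<lambda>n. ?u n / r ^ n) \<and> (\<Sum>n. ?u n / r ^ n) < 1 \<and>
        (\<exists>C>0. limsup (\<lambda>n. ereal (?u n / \<gamma> n)) = ereal C)) \<longleftrightarrow>
      (summable (\<lambda>j. b (Suc j) / r ^ Suc j) \<and> ?l * (\<Sum>j. b (Suc j) / r ^ Suc j) < 1 \<and>
        (\<exists>C>0. limsup (\<lambda>n. ereal (b n / \<gamma> n)) = ereal C))"
    by (intro conj_cong summ) (simp only: sum)
  with main show ?thesis by (rule trans[OF sym, rotated])
qed

end
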